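(* The interface bilinear form $a(\cdot,\cdot):\Lambda_h\times\Lambda_h\to\mathbb{R}$, $$a(\lambda_h,\eta)=\sum_{i=1}^n a_i(\lambda_h,\eta),\qquad a_i(\lambda_h,\eta)=-\langle \sigma^*_{h,i}(\lambda_h)\,n_i,\eta\rangle_{\Gamma_i},$$ is symmetric and positive definite over $\Lambda_h$.
   Context: Setting. Let $d\in\{2,3\}$ and let $\Omega\subset\mathbb{R}^d$ be a simply connected bounded polygonal domain with outward unit normal $n$ and $\partial\Omega=\Gamma_D\cup\Gamma_N$, $\operatorname{meas}(\Gamma_D)>0$. Let $\mathbb{M},\mathbb{S},\mathbb{N}$ be the spaces of real $d\times d$ matrices, symmetric matrices and skew-symmetric matrices. The compliance tensor $A=A(x)$ is, at each $x\in\Omega$, a self-adjoint, bounded, uniformly positive definite linear operator $\mathbb{S}\to\mathbb{S}$, extended to an operator $\mathbb{M}\to\mathbb{M}$ with the same properties. The divergence of a matrix field is taken row-wise. $(\cdot,\cdot)_G$ is the $L^2(G)$ inner product and $\langle\cdot,\cdot\rangle_S$ the $L^2(S)$ inner product (or duality pairing) on a portion $S$ of a (subdomain) boundary. Put $\mathbb{X}=\{\tau\in H(\operatorname{div};\Omega,\mathbb{M}):\tau n=0\text{ on }\Gamma_N\}$, $V=L^2(\Omega,\mathbb{R}^d)$, $\mathbb{W}=L^2(\Omega,\mathbb{N})$. Finite element spaces. $\mathcal{T}_h$ is a conforming, shape regular, quasi-uniform partition of $\Omega$ into simplices or rectangular elements, $h$ is the mesh size, and $\mathbb{X}_h\times V_h\times\mathbb{W}_h\subset\mathbb{X}\times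 V\times\mathbb{W}$ is any stable triple of mixed finite element spaces on $\mathcal{T}_h$ for linear elasticity with weakly imposed stress symmetry, such as the Amara–Thomas, PEERS, Stenberg, Arnold–Falk–Winther (and its rectangular/quadrilateral analogues), or Cockburn–Gopalakrishnan–Guzmán families. For these spaces $\operatorname{div}\mathbb{X}_h=V_h$, and there is a projection $\Pi:H^1(\Omega,\mathbb{M})\to\mathbb{X}_h$ with $(\operatorname{div}(\Pi\tau-\tau),v)_\Omega=0$ for all $v\in V_h$ and $\langle(\Pi\tau-\tau)n,\chi n\rangle_{\partial\Omega}=0$ for all $\chi\in\mathbb{X}_h$; the same holds for the restrictions to subdomains. Domain decomposition. $\Omega=\cup_{i=1}^n\Omega_i$ is a union of nonoverlapping shape regular polygonal subdomains (compatible with $\mathcal{T}_h$), $n_i$ is the outward unit normal on $\partial\Omega_i$, $\Gamma_{i,j}=\partial\Omega_i\cap\partial\Omega_j$, $\Gamma=\cup_{i,j}\Gamma_{i,j}$, $\Gamma_i=\partial\Omega_i\cap\Gamma=\partial\Omega_i\setminus\partial\Omega$. $\mathbb{X}_{h,i},V_{h,i},\mathbb{W}_{h,i}$ are the restrictions of $\mathbb{X}_h,V_h,\mathbb{W}_h$ to $\Omega_i$. The Lagrange multiplier space is $\Lambda_h=\bigoplus_{i,j}\Lambda_{h,i,j}$, where $\Lambda_{h,i,j}=\mathbb{X}_h\,n$ is the space of normal traces on $\Gamma_{i,j}$. For $\lambda_h\in\Lambda_h$, $(\sigma^*_{h,i}(\lambda_h),u^*_{h,i}(\lambda_h),\gamma^*_{h,i}(\lambda_h))\in\mathbb{X}_{h,i}\times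 V_{h,i}\times\mathbb{W}_{h,i}$ is the solution of $$(A\sigma^*_{h,i}(\lambda_h),\tau)_{\Omega_i}+(u^*_{h,i}(\lambda_h),\operatorname{div}\tau)_{\Omega_i}+(\gamma^*_{h,i}(\lambda_h),\tau)_{\Omega_i}=\langle\lambda_h,\tau n_i\rangle_{\Gamma_i}\quad\forall\tau\in\mathbb{X}_{h,i},$$ $$(\operatorname{div}\sigma^*_{h,i}(\lambda_h),v)_{\Omega_i}=0\quad\forall v\in V_{h,i},\qquad(\sigma^*_{h,i}(\lambda_h),\xi)_{\Omega_i}=0\quad\forall\xi\in\mathbb{W}_{h,i}.$$
   Formalization: The minus sign in a_i is dropped (as printed, a is negative semidefinite); the inf-sup condition is assumed with displacements and rotations unrestricted across Γ (PEERS can fail otherwise); normal traces of X_{h,i} on different Γ_{i,j} are assumed independent. *)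

theory Defs
  imports "HOL-Analysis.Analysis"
begin

section \<open>Fields and $L^2$ inner products\<close>

type_synonym 'd vfield = "real^'d \<Rightarrow> real^'d"
type_synonym 'd mfield = "real^'d \<Rightarrow> real^'d^'d"

text \<open>Fields are total functions, and only their values on the domain in question matter.
  The library inner product on \<^typ>\<open>real^'d^'d\<close> is the Frobenius product.\<close>

definition L2 :: "(real^'d) set \<Rightarrow> (real^'d \<Rightarrow> 'b::euclidean_space) set" where
  "L2 G = {f. set_borel_measurable lborel G f \<and> set_integrable lborel G (\<lambda>x. (norm (f x))^2)}"

definition ip :: "(real^'d) set \<Rightarrow> (real^'d \<Rightarrow> 'b::euclidean_space) \<Rightarrow> (real^'d \<Rightarrow> 'b) \<Rightarrow> real" where
  "ip G f g = (LINT x:G|lborel. f x \<bullet> g x)"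

definition l2norm :: "(real^'d) set \<Rightarrow> (real^'d \<Rightarrow> 'b::euclidean_space) \<Rightarrow> real" where
  "l2norm G f = sqrt (ip G f f)"

definition symmetric_matrix :: "real^'d^'d \<Rightarrow> bool" where
  "symmetric_matrix M \<longleftrightarrow> transpose M = M"

definition skew_matrix :: "real^'d^'d \<Rightarrow> bool" where
  "skew_matrix M \<longleftrightarrow> transpose M = - M"

definition compliance_tensor :: "(real^'d) set \<Rightarrow> (real^'d \<Rightarrow> real^'d^'d \<Rightarrow> real^'d^'d) \<Rightarrow> bool" where
  "compliance_tensor G A \<longleftrightarrow>
     (\<forall>x\<in>G. linear (A x)) \<and>
     (\<forall>x\<in>G. \<forall>M. symmetric_matrix M \<longrightarrow> symmetric_matrix (A x M)) \<and>
     (\<forall>x\<in>G. \<forall>M N. A x M \<bullet> N = M \<bullet> A x N) \<and>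
     (\<exists>a0 a1. 0 < a0 \<and> (\<forall>x\<in>G. \<forall>M. a0 * (norm M)^2 \<le> A x M \<bullet> M \<and> norm (A x M) \<le> a1 * norm M)) \<and>
     (\<forall>M. set_borel_measurable lborel G (\<lambda>x. A x M))"


section \<open>Weak derivatives, divergence and $H(\mathrm{div})$\<close>

definition C1 :: "(real^'d \<Rightarrow> 'b::real_normed_vector) \<Rightarrow> bool" where
  "C1 \<phi> \<longleftrightarrow> (\<exists>\<phi>'. (\<forall>x. (\<phi> has_derivative blinfun_apply (\<phi>' x)) (at x)) \<and> continuous_on UNIV \<phi>')"

definition test_function :: "(real^'d) set \<Rightarrow> (real^'d \<Rightarrow> 'b::real_normed_vector) \<Rightarrow> bool" where
  "test_function G \<phi> \<longleftrightarrow> C1 \<phi> \<and> (\<exists>K. compact K \<and> K \<subseteq> G \<and> (\<forall>x. x \<notin> K \<longrightarrow> \<phi> x = 0))"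

definition grad :: "('d::finite) vfield \<Rightarrow> 'd mfield" where
  "grad \<phi> x = jacobian \<phi> (at x)"

definition has_weak_div :: "(real^'d) set \<Rightarrow> 'd mfield \<Rightarrow> 'd vfield \<Rightarrow> bool" where
  "has_weak_div G \<tau> g \<longleftrightarrow> g \<in> L2 G \<and> (\<forall>\<phi>. test_function G \<phi> \<longrightarrow> ip G \<tau> (grad \<phi>) = - ip G g \<phi>)"

text \<open>The row-wise divergence; it is determined up to a null set.\<close>

definition wdiv :: "(real^'d) set \<Rightarrow> 'd mfield \<Rightarrow> 'd vfield" where
  "wdiv G \<tau> = (SOME g. has_weak_div G \<tau> g)"

definition Hdiv :: "(real^'d) set \<Rightarrow> 'd mfield set" where
  "Hdiv G = {\<tau> \<in> L2 G. \<exists>g. has_weak_div G \<tau> g}"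

definition hdiv_norm :: "(real^'d) set \<Rightarrow> 'd mfield \<Rightarrow> real" where
  "hdiv_norm G \<tau> = sqrt (ip G \<tau> \<tau> + ip G (wdiv G \<tau>) (wdiv G \<tau>))"

definition H1 :: "(real^'d) set \<Rightarrow> 'd mfield set" where
  "H1 G = {\<tau> \<in> L2 G. \<forall>l. \<exists>g \<in> L2 G. \<forall>\<psi>::real^'d \<Rightarrow> real. test_function G \<psi> \<longrightarrow>
     (LINT x:G|lborel. frechet_derivative \<psi> (at x) (axis l 1) *\<^sub>R \<tau> x)
       = - (LINT x:G|lborel. \<psi> x *\<^sub>R g x)}"

text \<open>The left-hand side of Green's formula, i.e. the pairing of the normal trace of \<open>\<tau>\<close> in
  $H^{-1/2}(\partial G)$ with the trace of \<open>\<phi>\<close>.\<close>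

definition green :: "(real^'d) set \<Rightarrow> 'd mfield \<Rightarrow> 'd vfield \<Rightarrow> real" where
  "green G \<tau> \<phi> = ip G \<tau> (grad \<phi>) + ip G (wdiv G \<tau>) \<phi>"

text \<open>The fields of $H(\mathrm{div};G)$ with \<open>\<tau> n = 0\<close> on $\partial G\cap\Gamma_N$,
  the boundary condition being understood by duality.\<close>

definition Hdiv_N :: "(real^'d) set \<Rightarrow> (real^'d) set \<Rightarrow> 'd mfield set" where
  "Hdiv_N G \<Gamma>N = {\<tau> \<in> Hdiv G. \<forall>\<phi>. C1 \<phi> \<and> (\<forall>x \<in> frontier G - \<Gamma>N. \<phi> x = 0) \<longrightarrow> green G \<tau> \<phi> = 0}"


section \<open>Domains and meshes\<close>

text \<open>Requiring a domain to be the interior of its closure excludes slits.\<close>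

definition polygonal_domain :: "(real^'d) set \<Rightarrow> bool" where
  "polygonal_domain G \<longleftrightarrow> open G \<and> connected G \<and> bounded G \<and> G \<noteq> {} \<and> G = interior (closure G) \<and>
     (\<exists>P. finite P \<and> (\<forall>K\<in>P. polytope K) \<and> closure G = \<Union>P)"

definition rectangular :: "(real^'d) set \<Rightarrow> bool" where
  "rectangular E \<longleftrightarrow> (\<exists>c (b::real^'d) (f::real^'d \<Rightarrow> real^'d). orthogonal_transformation f \<and>
     (\<forall>i. 0 < b $ i) \<and> E = (\<lambda>x. c + f x) ` cbox 0 b)"

definition element :: "(real^'d) set \<Rightarrow> bool" where
  "element E \<longleftrightarrow> int CARD('d) simplex E \<or> rectangular E"

definition shape_regular :: "real \<Rightarrow> (real^'d) set \<Rightarrow> bool" where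
  "shape_regular \<kappa> S \<longleftrightarrow> (\<exists>x r. 0 < r \<and> ball x r \<subseteq> S \<and> diameter S \<le> \<kappa> * r)"

definition mesh_size :: "(real^'d) set set \<Rightarrow> real" where
  "mesh_size T = Max (diameter ` T)"

definition is_mesh :: "real \<Rightarrow> (real^'d) set \<Rightarrow> (real^'d) set set \<Rightarrow> bool" where
  "is_mesh \<kappa> G T \<longleftrightarrow> finite T \<and> \<Union>T = closure G \<and>
     (\<forall>E\<in>T. element E \<and> shape_regular \<kappa> E \<and> mesh_size T \<le> \<kappa> * diameter E) \<and>
     (\<forall>E\<in>T. \<forall>E'\<in>T. E \<inter> E' face_of E \<and> E \<inter> E' face_of E')"

definition mesh_facets :: "(real^'d) set set \<Rightarrow> (real^'d) set set" where
  "mesh_facets T = {F. \<exists>E\<in>T. F facet_of E}"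

text \<open>A portion of a domain boundary is represented by the mesh facets it consists of.\<close>

definition facets_in :: "(real^'d) set set \<Rightarrow> (real^'d) set \<Rightarrow> (real^'d) set set" where
  "facets_in T S = {F \<in> mesh_facets T. F \<subseteq> S}"


section \<open>Surface integrals and normal traces\<close>

definition facet_normal :: "(real^'d) set \<Rightarrow> real^'d" where
  "facet_normal F = (SOME \<nu>. norm \<nu> = 1 \<and> (\<forall>x\<in>F. \<forall>y\<in>F. \<nu> \<bullet> (x - y) = 0))"

text \<open>The $(d-1)$-dimensional Lebesgue measure on a flat facet \<open>F\<close>: by Fubini it is the image of
  the Lebesgue measure on the right prism of height one over \<open>F\<close> under the orthogonal
  projection onto the hyperplane of \<open>F\<close>.\<close>

definition facet_measure :: "(real^'d) set \<Rightarrow> (real^'d) measure" where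
  "facet_measure F =
     (let \<nu> = facet_normal F; p = (SOME p. p \<in> F)
      in distr (restrict_space lborel {x + t *\<^sub>R \<nu> |x t. x \<in> F \<and> 0 \<le> t \<and> t \<le> 1}) borel
           (\<lambda>y. y - ((y - p) \<bullet> \<nu>) *\<^sub>R \<nu>))"

definition surf_L2 :: "(real^'d) set set \<Rightarrow> 'd vfield set" where
  "surf_L2 \<F> = {f \<in> borel_measurable borel. \<forall>F\<in>\<F>. integrable (facet_measure F) (\<lambda>x. (norm (f x))^2)}"

definition surf_ip :: "(real^'d) set set \<Rightarrow> 'd vfield \<Rightarrow> 'd vfield \<Rightarrow> real" where
  "surf_ip \<F> f g = (\<Sum>F\<in>\<F>. LINT x|facet_measure F. f x \<bullet> g x)"

definition surf_eq :: "(real^'d) set set \<Rightarrow> 'd vfield \<Rightarrow> 'd vfield \<Rightarrow> bool" where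
  "surf_eq \<F> f g \<longleftrightarrow> (\<forall>F\<in>\<F>. AE x in facet_measure F. f x = g x)"

text \<open>As usual in $H(\mathrm{div};G)$, the normal trace \<open>\<tau> n\<close>, with \<open>n\<close> the \<^emph>\<open>outward\<close> unit
  normal on $\partial G$, is defined by Green's formula
  $(\tau,\nabla\varphi)_G+(\mathrm{div}\,\tau,\varphi)_G=\langle\tau n,\varphi\rangle_{\partial G}$;
  here it is a function in $L^2(\partial G)$, unique up to null sets.\<close>

definition is_normal_trace :: "(real^'d) set set \<Rightarrow> (real^'d) set \<Rightarrow> 'd mfield \<Rightarrow> 'd vfield \<Rightarrow> bool" where
  "is_normal_trace T G \<tau> t \<longleftrightarrow> t \<in> surf_L2 (facets_in T (frontier G)) \<and>
     (\<forall>\<phi>. C1 \<phi> \<longrightarrow> green G \<tau> \<phi> = surf_ip (facets_in T (frontier G)) t \<phi>)"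

definition ntrace :: "(real^'d) set set \<Rightarrow> (real^'d) set \<Rightarrow> 'd mfield \<Rightarrow> 'd vfield" where
  "ntrace T G \<tau> = (SOME t. is_normal_trace T G \<tau> t)"


section \<open>Mixed finite element spaces\<close>

text \<open>Finite-dimensional spaces of fields, spelled out because function types are not
  an instance of \<^class>\<open>real_vector\<close>.\<close>

definition fin_dim_space :: "(real^'d \<Rightarrow> 'b::euclidean_space) set \<Rightarrow> bool" where
  "fin_dim_space S \<longleftrightarrow> (\<exists>B. finite B \<and> S = {f. \<exists>c. f = (\<lambda>x. \<Sum>b\<in>B. c b *\<^sub>R b x)})"

definition piecewise_polynomial ::
    "(real^'d) set set \<Rightarrow> (real^'d) set \<Rightarrow> (real^'d \<Rightarrow> 'b::euclidean_space) \<Rightarrow> bool" where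
  "piecewise_polynomial T G f \<longleftrightarrow>
     (\<forall>E\<in>T. E \<subseteq> closure G \<longrightarrow> (\<exists>p. polynomial_function p \<and> (\<forall>x\<in>interior E. f x = p x)))"

definition fe_triple ::
    "(real^'d) set set \<Rightarrow> (real^'d) set \<Rightarrow> (real^'d) set \<Rightarrow>
     'd mfield set \<Rightarrow> 'd vfield set \<Rightarrow> 'd mfield set \<Rightarrow> bool" where
  "fe_triple T G \<Gamma>N X V W \<longleftrightarrow>
     fin_dim_space X \<and> X \<subseteq> Hdiv_N G \<Gamma>N \<and> (\<forall>\<tau>\<in>X. piecewise_polynomial T G \<tau>) \<and>
     fin_dim_space V \<and> V \<subseteq> L2 G \<and> (\<forall>v\<in>V. piecewise_polynomial T G v) \<and>
     fin_dim_space W \<and> W \<subseteq> L2 G \<and> (\<forall>\<xi>\<in>W. piecewise_polynomial T G \<xi> \<and> (\<forall>x\<in>G. skew_matrix (\<xi> x)))"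

definition div_onto :: "(real^'d) set \<Rightarrow> 'd mfield set \<Rightarrow> 'd vfield set \<Rightarrow> bool" where
  "div_onto G X V \<longleftrightarrow>
     (\<forall>\<tau>\<in>X. \<exists>v\<in>V. AE x in lborel. x \<in> G \<longrightarrow> wdiv G \<tau> x = v x) \<and>
     (\<forall>v\<in>V. \<exists>\<tau>\<in>X. AE x in lborel. x \<in> G \<longrightarrow> wdiv G \<tau> x = v x)"

text \<open>The projection acts on the $H^1$ fields satisfying the traction condition on $\Gamma_N$:
  for other fields the two identities are in general incompatible with \<open>P \<tau> \<in> X\<close>
  when $\Gamma_N\neq\emptyset$.\<close>

definition commuting_projection ::
    "(real^'d) set set \<Rightarrow> (real^'d) set \<Rightarrow> (real^'d) set \<Rightarrow> 'd mfield set \<Rightarrow> 'd vfield set \<Rightarrow>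
     ('d mfield \<Rightarrow> 'd mfield) \<Rightarrow> bool" where
  "commuting_projection T G \<Gamma>N X V P \<longleftrightarrow>
     (\<forall>\<tau> \<in> H1 G \<inter> Hdiv_N G \<Gamma>N. P \<tau> \<in> X \<and>
        (\<forall>v\<in>V. ip G (\<lambda>x. wdiv G (P \<tau>) x - wdiv G \<tau> x) v = 0) \<and>
        (\<forall>\<rho>\<in>X. surf_ip (facets_in T (frontier G))
                  (\<lambda>x. ntrace T G (P \<tau>) x - ntrace T G \<tau> x) (ntrace T G \<rho>) = 0)) \<and>
     (\<forall>\<tau> \<in> X \<inter> H1 G. P \<tau> = \<tau>) \<and>
     (\<forall>\<tau> \<in> H1 G \<inter> Hdiv_N G \<Gamma>N. \<forall>\<tau>' \<in> H1 G \<inter> Hdiv_N G \<Gamma>N. \<forall>c.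
        P (\<lambda>x. c *\<^sub>R \<tau> x + \<tau>' x) = (\<lambda>x. c *\<^sub>R P \<tau> x + P \<tau>' x))"

text \<open>The discrete inf-sup condition for elasticity with weakly imposed stress symmetry. The
  coercivity half of stability follows from \<^const>\<open>div_onto\<close> and \<^const>\<open>compliance_tensor\<close>.\<close>

definition inf_sup :: "real \<Rightarrow> (real^'d) set \<Rightarrow> 'd mfield set \<Rightarrow> 'd vfield set \<Rightarrow> 'd mfield set \<Rightarrow> bool" where
  "inf_sup \<beta> G X V W \<longleftrightarrow>
     (\<forall>v\<in>V. \<forall>\<xi>\<in>W. \<exists>\<tau>\<in>X. hdiv_norm G \<tau> \<le> 1 \<and>
        \<beta> * (l2norm G v + l2norm G \<xi>) \<le> ip G v (wdiv G \<tau>) + ip G \<xi> \<tau>)"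

text \<open>For piecewise polynomial fields in $H(\mathrm{div};G)$ the existence of normal traces in
  $L^2(\partial G)$ is automatic, by the divergence theorem on each element; it is recorded
  because the library has no divergence theorem on polytopes.\<close>

definition stable_triple ::
    "real \<Rightarrow> (real^'d) set set \<Rightarrow> (real^'d) set \<Rightarrow> (real^'d) set \<Rightarrow>
     'd mfield set \<Rightarrow> 'd vfield set \<Rightarrow> 'd mfield set \<Rightarrow> bool" where
  "stable_triple \<beta> T G \<Gamma>N X V W \<longleftrightarrow>
     fe_triple T G \<Gamma>N X V W \<and> (\<forall>\<tau>\<in>X. \<exists>t. is_normal_trace T G \<tau> t) \<and>
     div_onto G X V \<and> (\<exists>P. commuting_projection T G \<Gamma>N X V P) \<and> inf_sup \<beta> G X V W"

definition restr :: "(real^'d) set \<Rightarrow> (real^'d \<Rightarrow> 'b::zero) set \<Rightarrow> (real^'d \<Rightarrow> 'b) set" where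
  "restr G S = (\<lambda>f x. if x \<in> G then f x else 0) ` S"


section \<open>Domain decomposition\<close>

definition boundary_partition ::
    "(real^'d) set set \<Rightarrow> (real^'d) set \<Rightarrow> (real^'d) set \<Rightarrow> (real^'d) set \<Rightarrow> bool" where
  "boundary_partition T G \<Gamma>D \<Gamma>N \<longleftrightarrow>
     frontier G = \<Gamma>D \<union> \<Gamma>N \<and> \<Gamma>D = \<Union>(facets_in T \<Gamma>D) \<and> \<Gamma>N = \<Union>(facets_in T \<Gamma>N) \<and>
     facets_in T \<Gamma>D \<inter> facets_in T \<Gamma>N = {} \<and>
     0 < (\<Sum>F\<in>facets_in T \<Gamma>D. measure (facet_measure F) F)"

definition decomposition ::
    "real \<Rightarrow> (real^'d) set set \<Rightarrow> (real^'d) set \<Rightarrow> nat \<Rightarrow> (nat \<Rightarrow> (real^'d) set) \<Rightarrow> bool" where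
  "decomposition \<kappa> T G n \<Omega>s \<longleftrightarrow>
     1 \<le> n \<and> closure G = (\<Union>i\<in>{1..n}. closure (\<Omega>s i)) \<and>
     (\<forall>i\<in>{1..n}. \<forall>j\<in>{1..n}. i \<noteq> j \<longrightarrow> \<Omega>s i \<inter> \<Omega>s j = {}) \<and>
     (\<forall>i\<in>{1..n}. polygonal_domain (\<Omega>s i) \<and> shape_regular \<kappa> (\<Omega>s i) \<and>
        closure (\<Omega>s i) = \<Union>{E\<in>T. E \<subseteq> closure (\<Omega>s i)})"

text \<open>The facets of $\Gamma_{i,j}$ and of $\Gamma_i=\bigcup_{j\neq i}\Gamma_{i,j}$.\<close>

definition Gam2 :: "(real^'d) set set \<Rightarrow> (nat \<Rightarrow> (real^'d) set) \<Rightarrow> nat \<Rightarrow> nat \<Rightarrow> (real^'d) set set" where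
  "Gam2 T \<Omega>s i j = facets_in T (frontier (\<Omega>s i) \<inter> frontier (\<Omega>s j))"

definition Gam1 :: "(real^'d) set set \<Rightarrow> nat \<Rightarrow> (nat \<Rightarrow> (real^'d) set) \<Rightarrow> nat \<Rightarrow> (real^'d) set set" where
  "Gam1 T n \<Omega>s i = (\<Union>j\<in>{1..n}-{i}. Gam2 T \<Omega>s i j)"

text \<open>The fields whose restriction to each subdomain is the restriction of some member of \<open>S\<close>,
  i.e. $\bigoplus_i S|_{\Omega_i}$: any continuity across the interface is dropped. Up to
  null sets this changes nothing for discontinuous displacement and rotation spaces. For
  continuous rotations (PEERS) the local problems only see the spaces $W_{h,i}$, so what the
  interface form needs is the inf-sup condition with broken rotations; with rotations continuous
  across the interface it can be degenerate.\<close>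

definition broken ::
    "nat \<Rightarrow> (nat \<Rightarrow> (real^'d) set) \<Rightarrow> (real^'d \<Rightarrow> 'b::real_vector) set \<Rightarrow> (real^'d \<Rightarrow> 'b) set" where
  "broken n \<Omega>s S = {f. \<exists>g. (\<forall>i\<in>{1..n}. g i \<in> S) \<and>
     f = (\<lambda>x. \<Sum>i\<in>{1..n}. indicator (\<Omega>s i) x *\<^sub>R g i x)}"

text \<open>Normal traces on different interfaces of a subdomain can be prescribed independently, as is
  the case when the normal degrees of freedom are local to facets. Hence the normal traces of
  \<open>restr (\<Omega>s i) X\<close> on $\Gamma_i$ make up all of $\bigoplus_j\Lambda_{h,i,j}$.\<close>

definition independent_traces ::
    "(real^'d) set set \<Rightarrow> nat \<Rightarrow> (nat \<Rightarrow> (real^'d) set) \<Rightarrow> 'd mfield set \<Rightarrow> bool" where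
  "independent_traces T n \<Omega>s X \<longleftrightarrow>
     (\<forall>i\<in>{1..n}. \<forall>j\<in>{1..n}. i \<noteq> j \<longrightarrow> (\<forall>\<tau> \<in> restr (\<Omega>s i) X. \<exists>\<tau>' \<in> restr (\<Omega>s i) X.
        surf_eq (Gam2 T \<Omega>s i j) (ntrace T (\<Omega>s i) \<tau>') (ntrace T (\<Omega>s i) \<tau>) \<and>
        (\<forall>k\<in>{1..n}-{i,j}. surf_eq (Gam2 T \<Omega>s i k) (ntrace T (\<Omega>s i) \<tau>') (\<lambda>x. 0))))"

definition multiplier_space ::
    "(real^'d) set set \<Rightarrow> nat \<Rightarrow> (nat \<Rightarrow> (real^'d) set) \<Rightarrow> 'd mfield set \<Rightarrow> 'd vfield set" where
  "multiplier_space T n \<Omega>s X = {lam \<in> borel_measurable borel.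
     \<forall>i\<in>{1..n}. \<forall>j\<in>{1..n}. i \<noteq> j \<longrightarrow>
       (\<exists>\<tau> \<in> restr (\<Omega>s i) X. surf_eq (Gam2 T \<Omega>s i j) lam (ntrace T (\<Omega>s i) \<tau>))}"

definition local_solution ::
    "(real^'d) set set \<Rightarrow> nat \<Rightarrow> (nat \<Rightarrow> (real^'d) set) \<Rightarrow>
     (real^'d \<Rightarrow> real^'d^'d \<Rightarrow> real^'d^'d) \<Rightarrow> 'd mfield set \<Rightarrow> 'd vfield set \<Rightarrow> 'd mfield set \<Rightarrow>
     nat \<Rightarrow> 'd vfield \<Rightarrow> 'd mfield \<Rightarrow> 'd vfield \<Rightarrow> 'd mfield \<Rightarrow> bool" where
  "local_solution T n \<Omega>s A X V W i lam \<sigma> u \<gamma> \<longleftrightarrow>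
     \<sigma> \<in> restr (\<Omega>s i) X \<and> u \<in> restr (\<Omega>s i) V \<and> \<gamma> \<in> restr (\<Omega>s i) W \<and>
     (\<forall>\<tau> \<in> restr (\<Omega>s i) X.
        ip (\<Omega>s i) (\<lambda>x. A x (\<sigma> x)) \<tau> + ip (\<Omega>s i) u (wdiv (\<Omega>s i) \<tau>) + ip (\<Omega>s i) \<gamma> \<tau>
          = surf_ip (Gam1 T n \<Omega>s i) lam (ntrace T (\<Omega>s i) \<tau>)) \<and>
     (\<forall>v \<in> restr (\<Omega>s i) V. ip (\<Omega>s i) (wdiv (\<Omega>s i) \<sigma>) v = 0) \<and>
     (\<forall>\<xi> \<in> restr (\<Omega>s i) W. ip (\<Omega>s i) \<sigma> \<xi> = 0)"

text \<open>\<^bold>\<open>Sign.\<close> The source has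
  $a_i(\lambda,\eta)=-\langle\sigma^*_{h,i}(\lambda)n_i,\eta\rangle_{\Gamma_i}$ together with the right-hand side
  $+\langle\lambda,\tau n_i\rangle_{\Gamma_i}$ in \<^const>\<open>local_solution\<close>. Testing with
  $\tau=\sigma^*_{h,i}(\lambda)$ gives
  $\langle\sigma^*_{h,i}(\lambda)n_i,\lambda\rangle_{\Gamma_i}=(A\sigma^*_{h,i}(\lambda),\sigma^*_{h,i}(\lambda))_{\Omega_i}\ge 0$,
  so with both signs as printed $a$ would be negative semidefinite. The minus sign in $a_i$ is
  therefore dropped.\<close>

definition subdomain_form ::
    "(real^'d) set set \<Rightarrow> nat \<Rightarrow> (nat \<Rightarrow> (real^'d) set) \<Rightarrow> (nat \<Rightarrow> 'd vfield \<Rightarrow> 'd mfield) \<Rightarrow>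
     nat \<Rightarrow> 'd vfield \<Rightarrow> 'd vfield \<Rightarrow> real" where
  "subdomain_form T n \<Omega>s \<sigma>s i lam \<eta> = surf_ip (Gam1 T n \<Omega>s i) (ntrace T (\<Omega>s i) (\<sigma>s i lam)) \<eta>"

definition interface_form ::
    "(real^'d) set set \<Rightarrow> nat \<Rightarrow> (nat \<Rightarrow> (real^'d) set) \<Rightarrow> (nat \<Rightarrow> 'd vfield \<Rightarrow> 'd mfield) \<Rightarrow>
     'd vfield \<Rightarrow> 'd vfield \<Rightarrow> real" where
  "interface_form T n \<Omega>s \<sigma>s lam \<eta> = (\<Sum>i\<in>{1..n}. subdomain_form T n \<Omega>s \<sigma>s i lam \<eta>)"

definition bilinear_form_on :: "('d::finite) vfield set \<Rightarrow> ('d vfield \<Rightarrow> 'd vfield \<Rightarrow> real) \<Rightarrow> bool" where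
  "bilinear_form_on S a \<longleftrightarrow> (\<forall>f\<in>S. \<forall>g\<in>S. \<forall>h\<in>S. \<forall>c.
     a (\<lambda>x. c *\<^sub>R f x + g x) h = c * a f h + a g h \<and>
     a h (\<lambda>x. c *\<^sub>R f x + g x) = c * a h f + a h g)"

end

theory Submission
  imports Defs
begin

text \<open>Testing the local problem for \<open>\<eta>\<close> with $\sigma^*_{h,i}(\lambda)$ gives
  $a_i(\lambda,\eta)=(A\sigma^*_{h,i}(\eta),\sigma^*_{h,i}(\lambda))_{\Omega_i}$, hence symmetry and
  semidefiniteness. If $a(\lambda,\lambda)=0$, all local stresses vanish. Testing the local problems
  with the restrictions of a global field of $\mathbb{X}_h$ and adding them up, the interface terms
  cancel, because the outward normal traces of such a field from the two sides of an interface are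
  opposite; so the broken inf-sup condition makes the local displacements and rotations vanish.
  Then \<open>\<lambda>\<close> is orthogonal to all normal traces, in particular to itself on each interface.

  Normal traces and weak divergences being given only by duality, their linearity (on which the
  bilinearity of \<open>a\<close> rests) and the cancellation need uniqueness, which comes from test
  functions: $C^1$ cutoffs approximate the indicator of any open set, facets overlap in null sets,
  and an interface facet lies in the open set \<open>\<Omega>\<close> up to a null set.\<close>


section \<open>Test functions\<close>

text \<open>No single \<open>a_i\<close> need be definite: on a subdomain away from
  \<open>\<Gamma>D\<close>, a rigid motion, its constant rotation and its boundary values solve the
  local problem with zero stress whenever the discrete spaces contain them. Vanishing stresses thus
  leave the local displacements and rotations open, and the inf-sup condition on one subdomain
  cannot remove them, since the multiplier is part of the data of that problem. Fields of
  \<open>X\<close> can, because the multiplier terms of all subdomains cancel for them. The local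
  fields glue to members of the broken spaces, in general not of \<open>V\<close> and
  \<open>W\<close>; hence the broken inf-sup condition. Fields and multipliers are total functions,
  so a multiplier is zero when it vanishes almost everywhere on each facet of each
  \<open>Gam1\<close>. The surface measure is the image of Lebesgue measure on a prism, so null sets
  on a facet are found by a dimension count in the volume.\<close>

lemma C1_iff:
  fixes f :: "real^'d \<Rightarrow> 'b::real_normed_vector"
  shows "C1 f \<longleftrightarrow> (\<exists>D. (\<forall>x. (f has_derivative D x) (at x)) \<and> (\<forall>h. continuous_on UNIV (\<lambda>x. D x h)))"
proof
  assume "C1 f"
  then obtain f' where f': "\<And>x. (f has_derivative blinfun_apply (f' x)) (at x)" "continuous_on UNIV f'"
    unfolding C1_def by blast
  have "continuous_on UNIV (\<lambda>x. blinfun_apply (f' x) h)" for h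
    by (intro continuous_intros f')
  with f'(1) show "\<exists>D. (\<forall>x. (f has_derivative D x) (at x)) \<and> (\<forall>h. continuous_on UNIV (\<lambda>x. D x h))"
    by (intro exI[of _ "\<lambda>x. blinfun_apply (f' x)"]) auto
next
  assume "\<exists>D. (\<forall>x. (f has_derivative D x) (at x)) \<and> (\<forall>h. continuous_on UNIV (\<lambda>x. D x h))"
  then obtain D where D: "\<And>x. (f has_derivative D x) (at x)" "\<And>h. continuous_on UNIV (\<lambda>x. D x h)"
    by blast
  have *: "blinfun_apply (Blinfun (D x)) = D x" for x
    using D(1) has_derivative_bounded_linear bounded_linear_Blinfun_apply by blast
  \<comment> \<open>In finite dimension, continuity in every fixed direction already gives
    continuity in the operator norm.\<close>
  have "continuous_on UNIV (\<lambda>x. Blinfun (D x))"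
    by (rule continuous_on_blinfun_componentwise) (simp add: * D(2))
  then show "C1 f" unfolding C1_def
    using D(1) * by (intro exI[of _ "\<lambda>x. Blinfun (D x)"]) auto
qed

lemma C1_E:
  assumes "C1 f"
  obtains D where "\<And>x. (f has_derivative D x) (at x)" "\<And>h. continuous_on UNIV (\<lambda>x. D x h)"
  using assms C1_iff by blast

lemma C1_I:
  assumes "\<And>x. (f has_derivative D x) (at x)" "\<And>h. continuous_on UNIV (\<lambda>x. D x h)"
  shows "C1 f"
  using assms C1_iff by blast

lemma C1_continuous: "C1 f \<Longrightarrow> continuous_on S f"
  by (elim C1_E) (meson continuous_on_eq_continuous_within continuous_on_subset has_derivative_continuous subset_UNIV)

lemma C1_const [simp]: "C1 (\<lambda>x. c)"
  by (rule C1_I[where D = "\<lambda>x h. 0"]) auto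

lemma C1_add:
  assumes "C1 f" "C1 g" shows "C1 (\<lambda>x. f x + g x)"
proof -
  obtain D where D: "\<And>x. (f has_derivative D x) (at x)" "\<And>h. continuous_on UNIV (\<lambda>x. D x h)"
    using assms(1) unfolding C1_iff by blast
  obtain D' where D': "\<And>x. (g has_derivative D' x) (at x)" "\<And>h. continuous_on UNIV (\<lambda>x. D' x h)"
    using assms(2) unfolding C1_iff by blast
  show ?thesis
    by (rule C1_I[where D = "\<lambda>x h. D x h + D' x h"])
       (use D D' in \<open>auto intro!: continuous_intros has_derivative_add\<close>)
qed

lemma C1_sum:
  assumes "\<And>i. i \<in> I \<Longrightarrow> C1 (f i)" shows "C1 (\<lambda>x. \<Sum>i\<in>I. f i x)"
  using assms by (induction I rule: infinite_finite_induct) (auto intro!: C1_add)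

lemma C1_scaleR:
  fixes f :: "real^'d \<Rightarrow> real" and g :: "real^'d \<Rightarrow> 'b::real_normed_vector"
  assumes "C1 f" "C1 g" shows "C1 (\<lambda>x. f x *\<^sub>R g x)"
proof -
  obtain D where D: "\<And>x. (f has_derivative D x) (at x)" "\<And>h. continuous_on UNIV (\<lambda>x. D x h)"
    using assms(1) unfolding C1_iff by blast
  obtain D' where D': "\<And>x. (g has_derivative D' x) (at x)" "\<And>h. continuous_on UNIV (\<lambda>x. D' x h)"
    using assms(2) unfolding C1_iff by blast
  show ?thesis
    by (rule C1_I[where D = "\<lambda>x h. f x *\<^sub>R D' x h + D x h *\<^sub>R g x"])
       (intro continuous_on_add continuous_on_scaleR has_derivative_scaleR C1_continuous D D' assms)+
qed

lemma C1_compose: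
  fixes f :: "real^'d \<Rightarrow> real" and S :: "real \<Rightarrow> real"
  assumes "C1 f" "\<And>t. (S has_field_derivative S' t) (at t)" "continuous_on UNIV S'"
  shows "C1 (\<lambda>x. S (f x))"
proof -
  obtain D where D: "\<And>x. (f has_derivative D x) (at x)" "\<And>h. continuous_on UNIV (\<lambda>x. D x h)"
    using assms(1) unfolding C1_iff by blast
  show ?thesis
  proof (rule C1_I[where D = "\<lambda>x h. S' (f x) * D x h"])
    show "((\<lambda>x. S (f x)) has_derivative (\<lambda>h. S' (f x) * D x h)) (at x)" for x
      using has_derivative_compose[OF D(1)[of x] assms(2)[of "f x", unfolded has_field_derivative_def]]
      by simp
    have "continuous_on UNIV (\<lambda>x. S' (f x))"
      using continuous_on_compose2[OF assms(3)] C1_continuous[OF assms(1)] by blast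
    then show "continuous_on UNIV (\<lambda>x. S' (f x) * D x h)" for h
      by (intro continuous_intros D(2))
  qed
qed

text \<open>Squaring the positive part removes its kink: the derivative \<open>2 * max 0 t\<close>
  is continuous. For positive \<open>r\<close> the function is positive exactly on the open
  ball.\<close>

lemma C1_ball_bump: "C1 (\<lambda>x::real^'d. (max 0 (r\<^sup>2 - (norm (x - a))\<^sup>2))\<^sup>2)"
proof -
  have 1: "C1 (\<lambda>x::real^'d. r\<^sup>2 - (norm (x - a))\<^sup>2)"
  proof (rule C1_I[where D = "\<lambda>x h. - 2 * ((x - a) \<bullet> h)"])
    show "((\<lambda>x. r\<^sup>2 - (norm (x - a))\<^sup>2) has_derivative (\<lambda>h. - 2 * ((x - a) \<bullet> h))) (at x)" for x
      unfolding power2_norm_eq_inner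
      by (auto intro!: derivative_eq_intros simp: inner_commute fun_eq_iff)
  qed (intro continuous_intros)
  have 2: "((\<lambda>t. (max 0 t)\<^sup>2) has_field_derivative 2 * max 0 t) (at t)" for t :: real
  proof (cases t "0::real" rule: linorder_cases)
    case less
    have "((\<lambda>t::real. 0) has_field_derivative 0) (at t)" by simp
    then have "((\<lambda>t::real. (max 0 t)\<^sup>2) has_field_derivative 0) (at t)"
      by (rule DERIV_cong_ev[THEN iffD1, rotated 3])
         (use less in \<open>auto intro!: eventually_mono[OF eventually_nhds_in_open[of "{..<0}"]]\<close>)
    then show ?thesis using less by simp
  next
    case greater
    have "((\<lambda>t::real. t\<^sup>2) has_field_derivative 2 * t) (at t)"
      by (auto intro!: derivative_eq_intros)
    then have "((\<lambda>t::real. (max 0 t)\<^sup>2) has_field_derivative 2 * t) (at t)"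
      by (rule DERIV_cong_ev[THEN iffD1, rotated 3])
         (use greater in \<open>auto intro!: eventually_mono[OF eventually_nhds_in_open[of "{0<..}"]]\<close>)
    then show ?thesis using greater by simp
  next
    case equal
    \<comment> \<open>Both sides are 0 at \<open>h = 0\<close> too, as division by zero yields
      0.\<close>
    have "(\<lambda>h::real. (max 0 h)\<^sup>2 / h) = (\<lambda>h. max 0 h)"
      by (auto simp: fun_eq_iff max_def power2_eq_square)
    moreover have "((\<lambda>h::real. max 0 h) \<longlongrightarrow> max 0 0) (at 0)"
      by (intro tendsto_intros)
    ultimately show ?thesis using equal by (simp add: DERIV_def)
  qed
  show ?thesis
    by (rule C1_compose[OF 1 2]) (intro continuous_intros)
qed

lemma test_function_scaleR:
  fixes s :: "real^'d \<Rightarrow> real" and \<phi> :: "real^'d \<Rightarrow> 'b::real_normed_vector"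
  assumes "test_function U s" "C1 \<phi>"
  shows "test_function U (\<lambda>x. s x *\<^sub>R \<phi> x)"
proof -
  obtain K where "compact K" "K \<subseteq> U" "\<And>x. x \<notin> K \<Longrightarrow> s x = 0"
    using assms(1) unfolding test_function_def by blast
  then show ?thesis
    using assms unfolding test_function_def
    by (intro conjI exI[of _ K] C1_scaleR) auto
qed

text \<open>Countably many balls whose closed balls stay inside \<open>U\<close> cover
  \<open>U\<close>. A finite sum of their bumps has compact support in \<open>U\<close>, and at each
  point of \<open>U\<close> the partial sums eventually stay above a positive number. Multiplying by
  \<open>k\<close> and applying a bounded saturation drives the values to 1 there, while outside
  \<open>U\<close> every bump vanishes.\<close>

lemma test_function_cutoffs:
  fixes U :: "(real^'d) set"
  assumes "open U"
  obtains s :: "nat \<Rightarrow> real^'d \<Rightarrow> real"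
  where "\<And>k. test_function U (s k)" "\<And>k x. 0 \<le> s k x" "\<And>k x. s k x \<le> 1"
    "\<And>x. (\<lambda>k. s k x) \<longlonglongrightarrow> indicator U x"
proof -
  define \<B> where "\<B> = {ball a r | a r. cball a r \<subseteq> (U::(real^'d) set)}"
  have U: "\<Union>\<B> = U"
  proof
    show "\<Union>\<B> \<subseteq> U" by (force simp: \<B>_def)
    show "U \<subseteq> \<Union>\<B>"
    proof
      fix x assume "x \<in> U"
      then obtain r where "r > 0" "cball x r \<subseteq> U" using assms open_contains_cball by blast
      then show "x \<in> \<Union>\<B>" unfolding \<B>_def by (auto intro!: exI[of _ "ball x r"])
    qed
  qed
  have "\<And>S. S \<in> \<B> \<Longrightarrow> open S" by (auto simp: \<B>_def)
  then obtain \<B>' where B': "\<B>' \<subseteq> \<B>" "countable \<B>'" "\<Union>\<B>' = \<Union>\<B>"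
    using Lindelof[of \<B>] by metis
  \<comment> \<open>The empty set, as a ball of radius -1, is added so that the enumerated family is
    nonempty even when \<open>U\<close> is empty.\<close>
  have emp: "{} \<in> \<B>" unfolding \<B>_def
    by (rule CollectI, rule exI[of _ 0], rule exI[of _ "-1"]) (simp add: ball_empty cball_empty)
  define b where "b = from_nat_into (insert {} \<B>')"
  have b: "b m \<in> \<B>" for m
    using from_nat_into[of "insert {} \<B>'" m] B' emp by (auto simp: b_def)
  have bU: "(\<Union>m. b m) = U"
  proof -
    have "range b = insert {} \<B>'" unfolding b_def using B' by (simp add: range_from_nat_into)
    then have "(\<Union>m. b m) = \<Union>\<B>'" by auto
    then show ?thesis using B' U by simp
  qed
  have "\<exists>a r. \<forall>m. b m = ball (a m) (r m) \<and> cball (a m) (r m) \<subseteq> U"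
    using b unfolding \<B>_def mem_Collect_eq by metis
  then obtain a r where ar: "\<And>m. b m = ball (a m) (r m)" "\<And>m. cball (a m) (r m) \<subseteq> U"
    by blast
  define f :: "nat \<Rightarrow> real^'d \<Rightarrow> real"
    where "f m = (if 0 < r m then (\<lambda>x. (max 0 ((r m)\<^sup>2 - (norm (x - a m))\<^sup>2))\<^sup>2) else (\<lambda>x. 0))" for m
  have fC: "C1 (f m)" for m unfolding f_def by (simp add: C1_ball_bump)
  have f0: "f m x \<ge> 0" for m x by (simp add: f_def)
  have fpos: "f m x > 0 \<longleftrightarrow> x \<in> b m" for m x
  proof (cases "0 < r m")
    case True
    have "(max 0 ((r m)\<^sup>2 - (norm (x - a m))\<^sup>2))\<^sup>2 > 0 \<longleftrightarrow> (norm (x - a m))\<^sup>2 < (r m)\<^sup>2"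
      by (auto simp: max_def)
    also have "\<dots> \<longleftrightarrow> norm (x - a m) < r m"
      using True by (metis norm_ge_zero power2_less_imp_less power_strict_mono less_imp_le pos2)
    finally show ?thesis using True by (auto simp: f_def ar dist_norm norm_minus_commute)
  next
    case False
    then have "b m = {}" using ar(1) by (simp add: ball_empty)
    with False show ?thesis by (simp add: f_def)
  qed
  define F where "F k x = (\<Sum>m\<le>k. f m x)" for k x
  \<comment> \<open>A saturation with continuous derivative \<open>S'\<close>, value 0 at 0, range
    in [0, 1] and limit 1 at infinity.\<close>
  define S where "S t = t\<^sup>2 / (1 + t\<^sup>2)" for t :: real
  define S' where "S' t = 2 * t / (1 + t\<^sup>2)\<^sup>2" for t :: real
  have S_pos: "1 + t\<^sup>2 \<noteq> 0" for t :: real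
    using zero_le_power2[of t] by linarith
  have S': "(S has_field_derivative S' t) (at t)" for t
  proof -
    have "(S has_field_derivative ((2 * t) * (1 + t\<^sup>2) - t\<^sup>2 * (2 * t)) / ((1 + t\<^sup>2) * (1 + t\<^sup>2))) (at t)"
      unfolding S_def by (rule DERIV_divide) (auto intro!: derivative_eq_intros S_pos)
    moreover have "((2 * t) * (1 + t\<^sup>2) - t\<^sup>2 * (2 * t)) / ((1 + t\<^sup>2) * (1 + t\<^sup>2)) = S' t"
      unfolding S'_def power2_eq_square[of "1 + t\<^sup>2"] by (simp add: ring_distribs)
    ultimately show ?thesis by simp
  qed
  have S'c: "continuous_on UNIV S'"
    unfolding S'_def using S_pos by (intro continuous_intros) auto
  define s where "s k x = S (real k * F k x)" for k x
  have S01: "0 \<le> S t" "S t \<le> 1" for t unfolding S_def by (auto simp: add_pos_nonneg)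
  show ?thesis
  proof (rule that[of s])
    show "test_function U (s k)" for k
      unfolding test_function_def
    proof (intro conjI exI[of _ "\<Union>m\<le>k. cball (a m) (r m)"])
      have "C1 (\<lambda>x. real k *\<^sub>R F k x)" unfolding F_def by (intro C1_scaleR C1_sum fC) auto
      then show "C1 (s k)" unfolding s_def using C1_compose[OF _ S' S'c, of "\<lambda>x. real k * F k x"] by simp
      show "compact (\<Union>m\<le>k. cball (a m) (r m))" by (intro compact_UN) auto
      show "(\<Union>m\<le>k. cball (a m) (r m)) \<subseteq> U" using ar by blast
      show "\<forall>x. x \<notin> (\<Union>m\<le>k. cball (a m) (r m)) \<longrightarrow> s k x = 0"
      proof (intro allI impI)
        fix x assume x: "x \<notin> (\<Union>m\<le>k. cball (a m) (r m))"
        have "f m x = 0" if "m \<le> k" for m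
        proof -
          have "x \<notin> b m" using x that ar(1)[of m] by (force simp: less_imp_le)
          then show ?thesis using fpos[of m x] f0[of m x] by linarith
        qed
        then show "s k x = 0" by (simp add: s_def F_def S_def)
      qed
    qed
    show "0 \<le> s k x" "s k x \<le> 1" for k x unfolding s_def by (auto simp: S01)
    show "(\<lambda>k. s k x) \<longlonglongrightarrow> indicator U x" for x
    proof (cases "x \<in> U")
      case True
      then obtain m where m: "x \<in> b m" using bU by blast
      define \<delta> where "\<delta> = f m x"
      have "\<delta> > 0" using m fpos \<delta>_def by simp
      have F: "F k x \<ge> \<delta>" if "k \<ge> m" for k
        unfolding F_def \<delta>_def using that f0 by (intro member_le_sum) auto
      have "filterlim (\<lambda>k. real k * \<delta>) at_top sequentially"
        using \<open>\<delta> > 0\<close> filterlim_real_sequentially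
        by (intro filterlim_at_top_mult_tendsto_pos[OF tendsto_const]) auto
      then have "filterlim (\<lambda>k. real k * F k x) at_top sequentially"
        by (rule filterlim_at_top_mono)
           (use F in \<open>auto intro!: eventually_sequentiallyI[of m] mult_left_mono\<close>)
      moreover have "(S \<longlongrightarrow> 1) at_top"
      proof -
        have "((\<lambda>t::real. 1 - inverse (1 + t\<^sup>2)) \<longlongrightarrow> 1 - 0) at_top"
          by (intro tendsto_intros tendsto_inverse_0_at_top
              filterlim_tendsto_add_at_top[OF tendsto_const] filterlim_pow_at_top filterlim_ident) auto
        moreover have "1 - inverse (1 + t\<^sup>2) = S t" for t
          using S_pos[of t] by (simp add: S_def field_simps)
        ultimately show ?thesis by simp
      qed
      ultimately have "(\<lambda>k. S (real k * F k x)) \<longlonglongrightarrow> 1" by (rule filterlim_compose[rotated])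
      then show ?thesis using True by (simp add: s_def)
    next
      case False
      then have "x \<notin> b m" for m using bU by blast
      then have "f m x = 0" for m using fpos[of m x] f0[of m x] by force
      then have "s k x = 0" for k by (simp add: s_def F_def S_def)
      then show ?thesis using False by simp
    qed
  qed
qed

section \<open>The fundamental lemma of the calculus of variations\<close>

lemma AE_zero_if_integral_open_zero:
  fixes f :: "'a::topological_space \<Rightarrow> real"
  assumes [measurable_cong]: "sets M = sets borel" and f: "integrable M f"
    and open0: "\<And>U. open U \<Longrightarrow> (LINT x:U|M. f x) = 0"
  shows "AE x in M. f x = 0"
proof -
  have sf: "set_integrable M A f" if "A \<in> sets borel" for A
    using f that assms(1) unfolding set_integrable_def by (metis integrable_mult_indicator)
  have Int_stable_open: "Int_stable (Collect open :: 'a set set)"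
    by (auto simp: Int_stable_def)
  have bor: "sigma_sets UNIV (Collect open) = sets borel" unfolding borel_def by simp
  \<comment> \<open>Open sets are an intersection-stable generator of the Borel sets, so Dynkin
    induction extends the vanishing to all Borel sets. For complements the whole space, being open,
    supplies the total integral.\<close>
  have "(LINT x:A|M. f x) = 0" if "A \<in> sigma_sets UNIV (Collect open)" for A
    using Int_stable_open subset_UNIV[of "Collect open", folded Pow_UNIV] that
  proof (induction rule: sigma_sets_induct_disjoint)
    case (compl A)
    then have "A \<in> sets borel" by (simp only: bor)
    have "(LINT x:UNIV|M. f x) = (LINT x:A|M. f x) + (LINT x:(UNIV-A)|M. f x)"
      using set_integral_Un[of A "UNIV - A" M f] \<open>A \<in> sets borel\<close> sf by auto
    then show ?case using compl open0[of UNIV] by simp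
  next
    case (union A)
    then have "A i \<in> sets borel" for i by (auto simp only: bor)
    then have "(LINT x:(\<Union>i. A i)|M. f x) = (\<Sum>i. (LINT x:(A i)|M. f x))"
      using union sf by (intro lebesgue_integral_countable_add) (auto simp: disjoint_family_on_def assms(1))
    then show ?case using union by simp
  qed (use open0 in \<open>auto\<close>)
  then have "AE x in M. f x = (\<lambda>x. 0) x"
    by (intro density_unique_real f) (simp_all add: assms(1) bor)
  then show ?thesis by simp
qed

text \<open>The measure \<open>M\<close> is kept general so that both Lebesgue measure (for weak
  divergences) and facet measures (for normal traces) are covered. Cutoffs of
  \<open>U \<inter> O'\<close> times a unit vector are test functions, and dominated convergence
  replaces them by the indicator, one component at a time.\<close>

lemma AE_zero_if_integral_test_function_zero:
  fixes f :: "real^'d \<Rightarrow> real^'d"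
  assumes M: "sets M = sets borel" and f: "integrable M f" and "open U"
    and test0: "\<And>\<phi>. test_function U \<phi> \<Longrightarrow> (LINT x|M. f x \<bullet> \<phi> x) = 0"
  shows "AE x in M. x \<in> U \<longrightarrow> f x = 0"
proof -
  note [measurable_cong] = M
  have [measurable]: "U \<in> sets borel" using \<open>open U\<close> by simp
  have fi: "integrable M (\<lambda>x. f x $ i)" for i
    using integrable_inner_left[OF f, of "axis i 1"] by (simp add: inner_axis)
  have [measurable]: "(\<lambda>x. f x $ i) \<in> borel_measurable M" for i
    using fi by (rule borel_measurable_integrable)
  have "AE x in M. indicator U x * f x $ i = 0" for i
  proof (rule AE_zero_if_integral_open_zero[OF M])
    show "integrable M (\<lambda>x. indicator U x * f x $ i)"
      using integrable_mult_indicator[OF _ fi[of i], of U] M \<open>open U\<close> by simp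
    fix O' :: "(real^'d) set" assume "open O'"
    then have [measurable]: "O' \<in> sets borel" by simp
    obtain s :: "nat \<Rightarrow> real^'d \<Rightarrow> real" where s: "\<And>k. test_function (U \<inter> O') (s k)"
      "\<And>k x. 0 \<le> s k x" "\<And>k x. s k x \<le> 1" "\<And>x. (\<lambda>k. s k x) \<longlonglongrightarrow> indicator (U \<inter> O') x"
      using test_function_cutoffs[of "U \<inter> O'"] \<open>open U\<close> \<open>open O'\<close> by blast
    have [measurable]: "s k \<in> borel_measurable borel" for k
      using s(1)[of k] C1_continuous unfolding test_function_def by (blast intro: borel_measurable_continuous_onI)
    have "(LINT x|M. s k x * f x $ i) = 0" for k
    proof -
      have "test_function U (\<lambda>x. s k x *\<^sub>R axis i (1::real))"
        using test_function_scaleR[OF s(1)[of k], of "\<lambda>x. axis i (1::real)"]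
        unfolding test_function_def by auto
      from test0[OF this] show ?thesis by (simp add: inner_axis)
    qed
    moreover have "(\<lambda>k. LINT x|M. s k x * f x $ i) \<longlonglongrightarrow> (LINT x|M. indicator (U \<inter> O') x * f x $ i)"
    proof (rule integral_dominated_convergence[where w = "\<lambda>x. \<bar>f x $ i\<bar>"])
      show "AE x in M. norm (s k x * f x $ i) \<le> \<bar>f x $ i\<bar>" for k
        using s(2,3)[of k] by (auto simp: abs_mult intro!: mult_left_le_one_le)
      show "AE x in M. (\<lambda>k. s k x * f x $ i) \<longlonglongrightarrow> indicator (U \<inter> O') x * f x $ i"
        by (intro AE_I2 tendsto_intros s)
      show "integrable M (\<lambda>x. \<bar>f x $ i\<bar>)" using fi by (rule integrable_abs)
      show "(\<lambda>x. indicator (U \<inter> O') x * f x $ i) \<in> borel_measurable M"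
        by measurable
      show "(\<lambda>x. s k x * f x $ i) \<in> borel_measurable M" for k
        by measurable
    qed
    ultimately have "(LINT x|M. indicator (U \<inter> O') x * f x $ i) = 0"
      by (simp add: LIMSEQ_const_iff)
    then show "(LINT x:O'|M. indicator U x * f x $ i) = 0"
      by (simp add: set_lebesgue_integral_def indicator_inter_arith mult_ac)
  qed
  then have "AE x in M. \<forall>i. indicator U x * f x $ i = 0"
    by (rule eventually_all_finite)
  then show ?thesis by eventually_elim (auto simp: vec_eq_iff)
qed


section \<open>The $L^2$ inner product and the weak divergence\<close>

lemma set_borel_measurable_indicator:
  fixes f :: "real^'d \<Rightarrow> 'b::euclidean_space"
  shows "set_borel_measurable lborel G f \<longleftrightarrow> (\<lambda>x. indicator G x *\<^sub>R f x) \<in> borel_measurable borel"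
  by (simp add: set_borel_measurable_def)

lemma L2_cong:
  assumes "\<And>x. x \<in> G \<Longrightarrow> f x = g x"
  shows "f \<in> L2 G \<longleftrightarrow> g \<in> L2 G"
proof -
  have "(\<lambda>x. indicator G x *\<^sub>R f x) = (\<lambda>x. indicator G x *\<^sub>R g x)"
    "(\<lambda>x. indicator G x *\<^sub>R (norm (f x))\<^sup>2) = (\<lambda>x. indicator G x *\<^sub>R (norm (g x))\<^sup>2)"
    using assms by (auto simp: indicator_def fun_eq_iff)
  then show ?thesis
    unfolding L2_def set_borel_measurable_def set_integrable_def by simp
qed

lemma ip_cong:
  assumes "\<And>x. x \<in> G \<Longrightarrow> f x \<bullet> g x = f' x \<bullet> g' x"
  shows "ip G f g = ip G f' g'"
  unfolding ip_def set_lebesgue_integral_def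
  by (rule Bochner_Integration.integral_cong) (use assms in \<open>auto simp: indicator_def\<close>)

lemma ip_commute: "ip G f g = ip G g f"
  by (rule ip_cong) (rule inner_commute)

lemma abs_inner_le_sum_squares: "\<bar>a \<bullet> b\<bar> \<le> (norm a)\<^sup>2 + (norm b)\<^sup>2"
  for a b :: "'a::real_inner"
proof -
  have "\<bar>a \<bullet> b\<bar> \<le> norm a * norm b" by (rule Cauchy_Schwarz_ineq2)
  moreover have "2 * norm a * norm b \<le> (norm a)\<^sup>2 + (norm b)\<^sup>2"
    by (rule sum_squares_bound)
  moreover have "0 \<le> norm a * norm b" by simp
  ultimately show ?thesis by linarith
qed

lemma L2_inner_integrable:
  assumes "f \<in> L2 G" "g \<in> L2 G"
  shows "set_integrable lborel G (\<lambda>x. f x \<bullet> g x)"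
proof -
  have m: "(\<lambda>x. indicator G x *\<^sub>R f x) \<in> borel_measurable borel"
    "(\<lambda>x. indicator G x *\<^sub>R g x) \<in> borel_measurable borel"
    using assms by (simp_all add: L2_def set_borel_measurable_indicator)
  have i: "integrable lborel (\<lambda>x. indicator G x *\<^sub>R (norm (f x))\<^sup>2 + indicator G x *\<^sub>R (norm (g x))\<^sup>2)"
    using assms by (intro Bochner_Integration.integrable_add) (simp_all add: L2_def set_integrable_def)
  have "integrable lborel (\<lambda>x. indicator G x *\<^sub>R (f x \<bullet> g x))"
  proof (rule Bochner_Integration.integrable_bound[OF i])
    have "(\<lambda>x. (indicator G x *\<^sub>R f x) \<bullet> (indicator G x *\<^sub>R g x)) \<in> borel_measurable lborel"
      using m by (intro borel_measurable_inner) simp_all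
    then show "(\<lambda>x. indicator G x *\<^sub>R (f x \<bullet> g x)) \<in> borel_measurable lborel"
      by (rule measurable_cong[THEN iffD1, rotated]) (simp add: indicator_def)
    have "\<bar>f x \<bullet> g x\<bar> \<le> (norm (f x))\<^sup>2 + (norm (g x))\<^sup>2" for x
      by (rule abs_inner_le_sum_squares)
    then show "AE x in lborel. norm (indicator G x *\<^sub>R (f x \<bullet> g x))
        \<le> norm (indicator G x *\<^sub>R (norm (f x))\<^sup>2 + indicator G x *\<^sub>R (norm (g x))\<^sup>2)"
      by (intro AE_I2) (auto simp: indicator_def)
  qed
  then show ?thesis by (simp add: set_integrable_def)
qed

lemma L2_lincomb:
  assumes "f \<in> L2 G" "g \<in> L2 G"
  shows "(\<lambda>x. c *\<^sub>R f x + g x) \<in> L2 G"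
proof -
  have [measurable]: "(\<lambda>x. indicator G x *\<^sub>R f x) \<in> borel_measurable borel"
    "(\<lambda>x. indicator G x *\<^sub>R g x) \<in> borel_measurable borel"
    using assms by (simp_all add: L2_def set_borel_measurable_indicator)
  have "(\<lambda>x. indicator G x *\<^sub>R (c *\<^sub>R f x + g x))
      = (\<lambda>x. c *\<^sub>R (indicator G x *\<^sub>R f x) + indicator G x *\<^sub>R g x)"
    by (simp add: algebra_simps)
  moreover have "\<dots> \<in> borel_measurable borel" by measurable
  ultimately have m: "(\<lambda>x. indicator G x *\<^sub>R (c *\<^sub>R f x + g x)) \<in> borel_measurable borel"
    by (simp only:)
  have "(\<lambda>x. indicator G x *\<^sub>R (norm (c *\<^sub>R f x + g x))\<^sup>2)
      = (\<lambda>x. c\<^sup>2 * (indicator G x *\<^sub>R (f x \<bullet> f x)) + 2 * c * (indicator G x *\<^sub>R (f x \<bullet> g x))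
          + indicator G x *\<^sub>R (g x \<bullet> g x))"
    unfolding power2_norm_eq_inner inner_add_left inner_add_right
    by (simp add: fun_eq_iff inner_commute power2_eq_square algebra_simps)
  moreover have "integrable lborel \<dots>"
    using assms[THEN L2_inner_integrable] L2_inner_integrable[OF assms(1) assms(1)]
      L2_inner_integrable[OF assms] L2_inner_integrable[OF assms(2) assms(2)]
    unfolding set_integrable_def
    by (intro Bochner_Integration.integrable_add integrable_mult_right) simp_all
  ultimately show ?thesis
    using m by (simp add: L2_def set_borel_measurable_indicator set_integrable_def)
qed

lemma L2_zero: "(\<lambda>x. 0) \<in> L2 G"
  by (simp add: L2_def set_borel_measurable_indicator set_integrable_def)

lemma L2_subset:
  assumes "f \<in> L2 G" "H \<subseteq> G" "H \<in> sets borel"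
  shows "f \<in> L2 H"
proof -
  have e: "indicator H x *\<^sub>R y = indicator H x *\<^sub>R indicator G x *\<^sub>R y" for x and y :: "'c::real_vector"
    using assms(2) by (auto simp: indicator_def)
  have [measurable]: "(\<lambda>x. indicator G x *\<^sub>R f x) \<in> borel_measurable borel" "H \<in> sets borel"
    using assms by (simp_all add: L2_def set_borel_measurable_indicator)
  have "(\<lambda>x. indicator H x *\<^sub>R f x) \<in> borel_measurable borel"
    by (subst e) measurable
  moreover have "set_integrable lborel H (\<lambda>x. (norm (f x))\<^sup>2)"
    by (rule set_integrable_subset[of lborel G]) (use assms in \<open>simp_all add: L2_def\<close>)
  ultimately show ?thesis by (simp add: L2_def set_borel_measurable_indicator)
qed

lemma L2_bounded_multiplier:
  assumes "f \<in> L2 G" and "set_borel_measurable lborel G g"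
    and "\<And>x. x \<in> G \<Longrightarrow> norm (g x) \<le> C * norm (f x)"
  shows "g \<in> L2 G"
proof -
  have [measurable]: "(\<lambda>x. indicator G x *\<^sub>R g x) \<in> borel_measurable borel"
    using assms by (simp add: set_borel_measurable_indicator)
  have i: "integrable lborel (\<lambda>x. C\<^sup>2 * (indicator G x *\<^sub>R (norm (f x))\<^sup>2))"
    using assms by (simp add: L2_def set_integrable_def)
  have "integrable lborel (\<lambda>x. indicator G x *\<^sub>R (norm (g x))\<^sup>2)"
  proof (rule Bochner_Integration.integrable_bound[OF i])
    have "(\<lambda>x. (norm (indicator G x *\<^sub>R g x))\<^sup>2) \<in> borel_measurable lborel"
      by measurable
    then show "(\<lambda>x. indicator G x *\<^sub>R (norm (g x))\<^sup>2) \<in> borel_measurable lborel"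
      by (rule measurable_cong[THEN iffD1, rotated]) (simp add: indicator_def)
    have "(norm (g x))\<^sup>2 \<le> C\<^sup>2 * (norm (f x))\<^sup>2" if "x \<in> G" for x
      using power_mono[OF assms(3)[OF that], of 2] by (simp add: power_mult_distrib)
    then show "AE x in lborel. norm (indicator G x *\<^sub>R (norm (g x))\<^sup>2)
        \<le> norm (C\<^sup>2 * (indicator G x *\<^sub>R (norm (f x))\<^sup>2))"
      by (intro AE_I2) (simp add: indicator_def)
  qed
  with assms(2) show ?thesis by (simp add: L2_def set_integrable_def)
qed

lemma L2_const:
  fixes c :: "'b::euclidean_space" and G :: "(real^'d) set"
  assumes "bounded G" "G \<in> sets borel"
  shows "(\<lambda>x. c) \<in> L2 G"
  using assms emeasure_bounded_finite[OF assms(1)]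
  unfolding L2_def set_borel_measurable_indicator set_integrable_def
  by (auto intro!: integrable_scaleR_left)

lemma L2_continuous:
  fixes f :: "real^'d \<Rightarrow> 'b::euclidean_space"
  assumes "bounded G" "G \<in> sets borel" "continuous_on UNIV f"
  shows "f \<in> L2 G"
proof -
  have "compact (f ` closure G)"
    using assms by (intro compact_continuous_image) (auto intro: continuous_on_subset)
  then obtain C where C: "\<And>x. x \<in> G \<Longrightarrow> norm (f x) \<le> C"
    using closure_subset compact_imp_bounded bounded_iff by (metis image_eqI subsetD)
  have [measurable]: "f \<in> borel_measurable borel" "G \<in> sets borel"
    using assms borel_measurable_continuous_onI by blast+
  show ?thesis
    by (rule L2_bounded_multiplier[OF L2_const[OF assms(1,2), of "1::real"], where C = C])
       (simp_all add: C set_borel_measurable_indicator)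
qed

text \<open>On a bounded set constants are square integrable, so pairing with the basis vectors
  makes every component integrable.\<close>

lemma L2_imp_integrable:
  fixes f :: "real^'d \<Rightarrow> 'b::euclidean_space"
  assumes "f \<in> L2 G" "bounded G" "G \<in> sets borel"
  shows "set_integrable lborel G f"
proof -
  have "integrable lborel (\<lambda>x. (indicator G x *\<^sub>R f x) \<bullet> b)" for b
    using L2_inner_integrable[OF assms(1) L2_const[OF assms(2,3), of b]]
    by (simp add: set_integrable_def)
  then have "integrable lborel (\<lambda>x. \<Sum>b\<in>Basis. ((indicator G x *\<^sub>R f x) \<bullet> b) *\<^sub>R b)"
    by (intro Bochner_Integration.integrable_sum integrable_scaleR_left)
  then show ?thesis unfolding set_integrable_def euclidean_representation .
qed

lemma ip_lincomb_left:
  assumes "f \<in> L2 G" "g \<in> L2 G" "h \<in> L2 G"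
  shows "ip G (\<lambda>x. c *\<^sub>R f x + g x) h = c * ip G f h + ip G g h"
  using L2_inner_integrable[OF assms(1,3)] L2_inner_integrable[OF assms(2,3)]
  unfolding ip_def by (simp add: inner_add_left)

lemma ip_cong_AE:
  assumes "f \<in> L2 G" "f' \<in> L2 G" "g \<in> L2 G"
    and "AE x in lborel. x \<in> G \<longrightarrow> f x = f' x"
  shows "ip G f g = ip G f' g"
  unfolding ip_def set_lebesgue_integral_def
proof (rule integral_cong_AE)
  show "(\<lambda>x. indicat_real G x *\<^sub>R (f x \<bullet> g x)) \<in> borel_measurable lborel"
    "(\<lambda>x. indicat_real G x *\<^sub>R (f' x \<bullet> g x)) \<in> borel_measurable lborel"
    using L2_inner_integrable[OF assms(1,3)] L2_inner_integrable[OF assms(2,3)]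
    unfolding set_integrable_def by (blast intro: borel_measurable_integrable)+
  show "AE x in lborel. indicat_real G x *\<^sub>R (f x \<bullet> g x) = indicat_real G x *\<^sub>R (f' x \<bullet> g x)"
    using assms(4) by eventually_elim (auto simp: indicator_def)
qed

lemma ip_nonneg: "0 \<le> ip G f f"
  unfolding ip_def set_lebesgue_integral_def by (rule integral_nonneg_AE) simp

lemma ip_self_zero_imp_AE_zero:
  assumes "f \<in> L2 G" "ip G f f \<le> 0"
  shows "AE x in lborel. x \<in> G \<longrightarrow> f x = 0"
proof -
  have "(LINT x|lborel. indicator G x *\<^sub>R (f x \<bullet> f x)) = 0"
    using assms(2) ip_nonneg[of G f] unfolding ip_def set_lebesgue_integral_def by linarith
  moreover have "integrable lborel (\<lambda>x. indicator G x *\<^sub>R (f x \<bullet> f x))"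
    using L2_inner_integrable[OF assms(1,1)] by (simp add: set_integrable_def)
  ultimately have "AE x in lborel. indicator G x *\<^sub>R (f x \<bullet> f x) = 0"
    by (subst (asm) integral_nonneg_eq_0_iff_AE) simp_all
  then show ?thesis by eventually_elim (auto simp: indicator_def)
qed

section \<open>Gradients, weak divergences and Green's functional\<close>

lemma grad_nth: "(f has_derivative D) (at x) \<Longrightarrow> grad f x $ i $ j = D (axis j 1) $ i"
  unfolding grad_def jacobian_def matrix_def by (drule frechet_derivative_at) simp

lemma continuous_on_grad:
  fixes \<phi> :: "real^'d \<Rightarrow> real^'d"
  assumes "C1 \<phi>"
  shows "continuous_on UNIV (grad \<phi>)"
proof -
  obtain D where D: "\<And>x. (\<phi> has_derivative D x) (at x)" "\<And>h. continuous_on UNIV (\<lambda>x. D x h)"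
    using assms unfolding C1_iff by blast
  have "grad \<phi> = (\<lambda>x. \<chi> i j. D x (axis j 1) $ i)"
    using grad_nth[OF D(1)] by (simp add: fun_eq_iff vec_eq_iff)
  then show ?thesis by (simp add: D(2) continuous_on_vec_lambda continuous_on_component)
qed

text \<open>The complement of \<open>K\<close> is open, so \<open>\<phi>\<close> vanishes in a whole
  neighbourhood of \<open>x\<close>.\<close>

lemma grad_eq_zero:
  fixes \<phi> :: "real^'d \<Rightarrow> real^'d"
  assumes "closed K" "\<And>x. x \<notin> K \<Longrightarrow> \<phi> x = 0" "x \<notin> K"
  shows "grad \<phi> x = 0"
proof -
  have "(\<phi> has_derivative (\<lambda>h. 0)) (at x)"
    using has_derivative_transform_within_open[of "\<lambda>x. 0::real^'d" "\<lambda>h. 0" x UNIV "- K" \<phi>] assms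
    by auto
  from grad_nth[OF this] show ?thesis by (simp add: vec_eq_iff)
qed

lemma test_function_C1: "test_function G \<phi> \<Longrightarrow> C1 \<phi>"
  by (simp add: test_function_def)

lemma has_weak_div_unique:
  fixes G :: "(real^'d) set"
  assumes "open G" "bounded G" "has_weak_div G \<tau> g" "has_weak_div G \<tau> g'"
  shows "AE x in lborel. x \<in> G \<longrightarrow> g x = g' x"
proof -
  have L: "g \<in> L2 G" "g' \<in> L2 G" using assms by (simp_all add: has_weak_div_def)
  have G: "G \<in> sets borel" using assms by simp
  have "AE x in lborel. x \<in> G \<longrightarrow> indicator G x *\<^sub>R (g x - g' x) = 0"
  proof (rule AE_zero_if_integral_test_function_zero)
    show "integrable lborel (\<lambda>x. indicator G x *\<^sub>R (g x - g' x))"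
      using L[THEN L2_imp_integrable, OF assms(2) G]
      by (auto simp: set_integrable_def algebra_simps)
    fix \<phi> :: "real^'d \<Rightarrow> real^'d" assume \<phi>: "test_function G \<phi>"
    have "\<phi> \<in> L2 G"
      using \<phi> by (intro L2_continuous assms(2) G C1_continuous test_function_C1)
    then have "ip G (\<lambda>x. (-1) *\<^sub>R g' x + g x) \<phi> = - ip G g' \<phi> + ip G g \<phi>"
      using L by (subst ip_lincomb_left) simp_all
    also have "\<dots> = 0" using assms(3,4) \<phi> unfolding has_weak_div_def by simp
    finally show "(LINT x|lborel. (indicator G x *\<^sub>R (g x - g' x)) \<bullet> \<phi> x) = 0"
      by (simp add: ip_def set_lebesgue_integral_def)
  qed (use assms in simp_all)
  then show ?thesis by eventually_elim simp
qed

lemma has_weak_div_wdiv: "\<tau> \<in> Hdiv G \<Longrightarrow> has_weak_div G \<tau> (wdiv G \<tau>)"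
  unfolding Hdiv_def wdiv_def using someI[of "has_weak_div G \<tau>"] by auto

lemma Hdiv_imp_L2: "\<tau> \<in> Hdiv G \<Longrightarrow> \<tau> \<in> L2 G"
  by (simp add: Hdiv_def)

lemma wdiv_L2: "\<tau> \<in> Hdiv G \<Longrightarrow> wdiv G \<tau> \<in> L2 G"
  using has_weak_div_wdiv unfolding has_weak_div_def by blast

lemma has_weak_div_lincomb:
  fixes G :: "(real^'d) set"
  assumes "open G" "bounded G" "\<tau> \<in> L2 G" "\<tau>' \<in> L2 G"
    and "has_weak_div G \<tau> g" "has_weak_div G \<tau>' g'"
  shows "has_weak_div G (\<lambda>x. c *\<^sub>R \<tau> x + \<tau>' x) (\<lambda>x. c *\<^sub>R g x + g' x)"
  unfolding has_weak_div_def
proof (intro conjI allI impI)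
  show "(\<lambda>x. c *\<^sub>R g x + g' x) \<in> L2 G"
    using assms unfolding has_weak_div_def by (intro L2_lincomb) auto
  fix \<phi> :: "real^'d \<Rightarrow> real^'d" assume \<phi>: "test_function G \<phi>"
  have "grad \<phi> \<in> L2 G" "\<phi> \<in> L2 G"
    using test_function_C1[OF \<phi>] assms(1,2)
    by (auto intro!: L2_continuous intro: continuous_on_grad C1_continuous)
  with \<phi> assms show "ip G (\<lambda>x. c *\<^sub>R \<tau> x + \<tau>' x) (grad \<phi>) = - ip G (\<lambda>x. c *\<^sub>R g x + g' x) \<phi>"
    unfolding has_weak_div_def by (simp add: ip_lincomb_left)
qed

lemma Hdiv_lincomb:
  fixes G :: "(real^'d) set"
  assumes "open G" "bounded G" "\<tau> \<in> Hdiv G" "\<tau>' \<in> Hdiv G"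
  shows "(\<lambda>x. c *\<^sub>R \<tau> x + \<tau>' x) \<in> Hdiv G"
  using has_weak_div_lincomb[OF assms(1,2) _ _ has_weak_div_wdiv has_weak_div_wdiv, of \<tau> \<tau>' c]
    L2_lincomb assms(3,4)
  unfolding Hdiv_def by blast

text \<open>The working form of uniqueness: \<open>wdiv\<close> is some choice among functions equal
  almost everywhere, so it is compared with another weak divergence only inside an inner
  product.\<close>

lemma ip_weak_div_eq_wdiv:
  fixes G :: "(real^'d) set"
  assumes "open G" "bounded G" "\<tau> \<in> Hdiv G" "has_weak_div G \<tau> g" "\<phi> \<in> L2 G"
  shows "ip G (wdiv G \<tau>) \<phi> = ip G g \<phi>"
  using assms has_weak_div_wdiv
  by (intro ip_cong_AE has_weak_div_unique[of G \<tau>]) (auto simp: has_weak_div_def)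

lemma green_lincomb:
  fixes G :: "(real^'d) set"
  assumes "open G" "bounded G" "\<tau> \<in> Hdiv G" "\<tau>' \<in> Hdiv G" "C1 \<phi>"
  shows "green G (\<lambda>x. c *\<^sub>R \<tau> x + \<tau>' x) \<phi> = c * green G \<tau> \<phi> + green G \<tau>' \<phi>"
proof -
  have L: "grad \<phi> \<in> L2 G" "\<phi> \<in> L2 G"
    using assms by (auto intro!: L2_continuous intro: continuous_on_grad C1_continuous)
  have "has_weak_div G (\<lambda>x. c *\<^sub>R \<tau> x + \<tau>' x) (\<lambda>x. c *\<^sub>R wdiv G \<tau> x + wdiv G \<tau>' x)"
    using assms by (intro has_weak_div_lincomb has_weak_div_wdiv Hdiv_imp_L2)
  then have "ip G (wdiv G (\<lambda>x. c *\<^sub>R \<tau> x + \<tau>' x)) \<phi> = ip G (\<lambda>x. c *\<^sub>R wdiv G \<tau> x + wdiv G \<tau>' x) \<phi>"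
    using assms L by (intro ip_weak_div_eq_wdiv Hdiv_lincomb)
  then show ?thesis
    using assms L unfolding green_def
    by (simp add: ip_lincomb_left wdiv_L2 Hdiv_imp_L2 distrib_left)
qed

text \<open>A test function on \<open>H\<close> is already zero outside \<open>H\<close>, hence is a
  test function on \<open>G\<close>. Agreement of \<open>\<tau>'\<close> with \<open>\<tau>\<close>
  is asked only on \<open>H\<close>, which admits the extension by zero used in
  \<open>restr\<close>.\<close>

lemma has_weak_div_subdomain:
  fixes G :: "(real^'d) set"
  assumes "has_weak_div G \<tau> g" "H \<subseteq> G" "open H" "\<And>x. x \<in> H \<Longrightarrow> \<tau>' x = \<tau> x"
  shows "has_weak_div H \<tau>' g"
  unfolding has_weak_div_def
proof (intro conjI allI impI)
  show "g \<in> L2 H" using assms unfolding has_weak_div_def by (auto intro: L2_subset)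
  fix \<phi> :: "real^'d \<Rightarrow> real^'d" assume \<phi>: "test_function H \<phi>"
  then obtain K where K: "compact K" "K \<subseteq> H" "\<And>x. x \<notin> K \<Longrightarrow> \<phi> x = 0"
    unfolding test_function_def by blast
  have \<phi>': "test_function G \<phi>"
    using \<phi> K assms(2) unfolding test_function_def by blast
  have z: "\<phi> x = 0" "grad \<phi> x = 0" if "x \<notin> H" for x
    using K that grad_eq_zero[of K \<phi> x] compact_imp_closed by blast+
  have "ip H \<tau>' (grad \<phi>) = ip G \<tau> (grad \<phi>)" "ip H g \<phi> = ip G g \<phi>"
    unfolding ip_def set_lebesgue_integral_def
    using z assms(2,4)
    by (auto intro!: Bochner_Integration.integral_cong simp: indicator_def)
  with \<phi>' assms(1) show "ip H \<tau>' (grad \<phi>) = - ip H g \<phi>"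
    unfolding has_weak_div_def by simp
qed


section \<open>The surface measure on a facet\<close>

lemma negligible_imp_null_sets_lborel:
  "negligible S \<Longrightarrow> S \<in> sets borel \<Longrightarrow> S \<in> null_sets lborel"
  by (metis negligible_iff_null_sets null_sets_completion_iff sets_lborel)

text \<open>A null superset, contained in no claim about \<open>S\<close> itself, because
  \<open>S\<close> need not be Borel. It is a hyperplane containing \<open>S\<close>.\<close>

lemma null_sets_lborel_lowdim:
  fixes S :: "'a::euclidean_space set"
  assumes "aff_dim S < DIM('a)"
  obtains N where "N \<in> null_sets lborel" "S \<subseteq> N"
proof -
  obtain a b where "a \<noteq> 0" "S \<subseteq> {x. a \<bullet> x = b}"
    using aff_lowdim_subset_hyperplane[OF assms] .
  moreover have "{x. a \<bullet> x = b} \<in> sets borel" by (intro borel_closed closed_hyperplane)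
  ultimately show ?thesis
    using that negligible_hyperplane[of a b] negligible_imp_null_sets_lborel by blast
qed

lemma facet_normal:
  fixes F :: "(real^'d) set"
  assumes "aff_dim F < CARD('d)"
  shows "norm (facet_normal F) = 1" "\<And>x y. x \<in> F \<Longrightarrow> y \<in> F \<Longrightarrow> facet_normal F \<bullet> (x - y) = 0"
proof -
  obtain a b where ab: "a \<noteq> 0" "F \<subseteq> {x. a \<bullet> x = b}"
    using aff_lowdim_subset_hyperplane[of F] assms by auto
  have "\<exists>\<nu>. norm \<nu> = 1 \<and> (\<forall>x\<in>F. \<forall>y\<in>F. \<nu> \<bullet> (x - y) = 0)"
  proof (intro exI[of _ "a /\<^sub>R norm a"] conjI ballI)
    show "norm (a /\<^sub>R norm a) = 1" using ab(1) by simp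
    fix x y assume "x \<in> F" "y \<in> F"
    then have "a \<bullet> x = b" "a \<bullet> y = b" using ab(2) by auto
    then show "(a /\<^sub>R norm a) \<bullet> (x - y) = 0" by (simp add: inner_diff_right)
  qed
  from someI_ex[OF this]
  show "norm (facet_normal F) = 1" "\<And>x y. x \<in> F \<Longrightarrow> y \<in> F \<Longrightarrow> facet_normal F \<bullet> (x - y) = 0"
    unfolding facet_normal_def by auto
qed

lemma sets_facet_measure [simp, measurable_cong]: "sets (facet_measure F) = sets borel"
  by (simp add: facet_measure_def Let_def)

lemma space_facet_measure [simp]: "space (facet_measure F) = UNIV"
  by (simp add: facet_measure_def Let_def)

text \<open>The projection in the definition undoes the shift along the normal, so the part of the
  prism that it sends into \<open>S\<close> is the prism over \<open>F \<inter> S\<close>.\<close>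

lemma emeasure_facet_measure:
  fixes F :: "(real^'d) set"
  assumes "compact F" "aff_dim F < CARD('d)" and S: "S \<in> sets borel"
  shows "{x + t *\<^sub>R facet_normal F |x t. x \<in> F \<inter> S \<and> 0 \<le> t \<and> t \<le> 1} \<in> sets borel"
    and "emeasure (facet_measure F) S
      = emeasure lborel {x + t *\<^sub>R facet_normal F |x t. x \<in> F \<inter> S \<and> 0 \<le> t \<and> t \<le> 1}"
proof -
  define \<nu> where "\<nu> = facet_normal F"
  define p where "p = (SOME p. p \<in> F)"
  define Q where "Q = {x + t *\<^sub>R \<nu> |x t. x \<in> F \<and> 0 \<le> t \<and> t \<le> 1}"
  define \<pi> where "\<pi> y = y - ((y - p) \<bullet> \<nu>) *\<^sub>R \<nu>" for y
  have Q: "Q = (\<lambda>(x, t). x + t *\<^sub>R \<nu>) ` (F \<times> {0..1})"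
    by (force simp: Q_def)
  have "compact Q" unfolding Q
    using assms(1) by (intro compact_continuous_image compact_Times)
      (auto simp: split_beta intro!: continuous_intros)
  then have Q_borel [measurable]: "Q \<in> sets borel" by (intro borel_closed compact_imp_closed)
  have [measurable]: "\<pi> \<in> borel_measurable borel" unfolding \<pi>_def by measurable
  have \<pi>: "\<pi> (x + t *\<^sub>R \<nu>) = x" if "x \<in> F" for x t
  proof -
    have "p \<in> F" unfolding p_def using that by (rule someI)
    then have "(x - p) \<bullet> \<nu> = 0"
      using facet_normal(2)[OF assms(2) that] by (simp add: \<nu>_def inner_commute)
    moreover have "\<nu> \<bullet> \<nu> = 1" using facet_normal(1)[OF assms(2)] by (simp add: \<nu>_def norm_eq_1)
    moreover have "(x + t *\<^sub>R \<nu> - p) \<bullet> \<nu> = (x - p) \<bullet> \<nu> + t * (\<nu> \<bullet> \<nu>)"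
      by (simp add: algebra_simps)
    ultimately show ?thesis by (simp add: \<pi>_def)
  qed
  have eq: "\<pi> -` S \<inter> Q = {x + t *\<^sub>R \<nu> |x t. x \<in> F \<inter> S \<and> 0 \<le> t \<and> t \<le> 1}"
    using \<pi> by (fastforce simp: Q_def)
  have "\<pi> -` S \<inter> Q \<in> sets borel"
    using measurable_sets[of \<pi> borel borel S] S by (intro sets.Int) auto
  then show "{x + t *\<^sub>R facet_normal F |x t. x \<in> F \<inter> S \<and> 0 \<le> t \<and> t \<le> 1} \<in> sets borel"
    unfolding eq \<nu>_def .
  have "facet_measure F = distr (restrict_space lborel Q) borel \<pi>"
    by (simp add: facet_measure_def Let_def Q_def \<nu>_def \<pi>_def[abs_def] p_def)
  moreover have "\<pi> \<in> measurable (restrict_space lborel Q) borel"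
    by (rule measurable_restrict_space1) simp
  ultimately have "emeasure (facet_measure F) S
      = emeasure (restrict_space lborel Q) (\<pi> -` S \<inter> Q)"
    using S by (simp add: emeasure_distr space_restrict_space)
  also have "\<dots> = emeasure lborel (\<pi> -` S \<inter> Q)"
    by (rule emeasure_restrict_space) auto
  finally show "emeasure (facet_measure F) S
      = emeasure lborel {x + t *\<^sub>R facet_normal F |x t. x \<in> F \<inter> S \<and> 0 \<le> t \<and> t \<le> 1}"
    unfolding eq \<nu>_def .
qed

lemma finite_measure_facet_measure:
  fixes F :: "(real^'d) set"
  assumes "compact F" "aff_dim F < CARD('d)"
  shows "finite_measure (facet_measure F)"
proof
  have "{x + t *\<^sub>R facet_normal F |x t. x \<in> F \<inter> UNIV \<and> 0 \<le> t \<and> t \<le> 1}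
      = (\<lambda>(x, t). x + t *\<^sub>R facet_normal F) ` (F \<times> {0..1})"
    by force
  moreover have "compact \<dots>"
    using assms(1) by (intro compact_continuous_image compact_Times)
      (auto simp: split_beta intro!: continuous_intros)
  ultimately show "emeasure (facet_measure F) (space (facet_measure F)) \<noteq> \<infinity>"
    using emeasure_facet_measure(2)[OF assms, of UNIV] emeasure_compact_finite by fastforce
qed

lemma AE_facet_measure_in_facet:
  fixes F :: "(real^'d) set"
  assumes "compact F" "aff_dim F < CARD('d)"
  shows "AE x in facet_measure F. x \<in> F"
proof (rule AE_I[where N = "- F"])
  show "- F \<in> sets (facet_measure F)" using compact_imp_closed[OF assms(1)] by (simp add: borel_open)
  then show "emeasure (facet_measure F) (- F) = 0"
    using emeasure_facet_measure(2)[OF assms, of "- F"] by simp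
qed auto

text \<open>The prism over \<open>S\<close> lies in the affine hull of \<open>S\<close> and one
  point shifted by the normal. This raises the dimension by at most one, so the hull still has
  dimension below that of the space and is Lebesgue null.\<close>

lemma AE_facet_measure_not_in_lowdim:
  fixes F :: "(real^'d) set"
  assumes "compact F" "aff_dim F < CARD('d)" "S \<subseteq> F" "closed S" "aff_dim S < int CARD('d) - 1"
  shows "AE x in facet_measure F. x \<notin> S"
proof (cases "S = {}")
  case False
  then obtain s where s: "s \<in> S" by blast
  define \<nu> where "\<nu> = facet_normal F"
  have "aff_dim (insert (s + \<nu>) S) < DIM(real^'d)"
    using assms(5) by (simp add: aff_dim_insert)
  then obtain N where N: "N \<in> null_sets lborel" "affine hull (insert (s + \<nu>) S) \<subseteq> N"
    using null_sets_lborel_lowdim[of "affine hull (insert (s + \<nu>) S)"] by auto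
  have sub: "{x + t *\<^sub>R \<nu> |x t. x \<in> F \<inter> S \<and> 0 \<le> t \<and> t \<le> 1} \<subseteq> N"
  proof safe
    fix x t assume "x \<in> S"
    let ?H = "affine hull (insert (s + \<nu>) S)"
    have "x \<in> ?H" "s \<in> ?H" "s + \<nu> \<in> ?H" using \<open>x \<in> S\<close> s by (simp_all add: hull_inc)
    \<comment> \<open>The normal is written as a difference of two points of the hull.\<close>
    then have "x + t *\<^sub>R ((s + \<nu>) - s) \<in> ?H"
      using affine_affine_hull by (intro mem_affine_3_minus) auto
    then show "x + t *\<^sub>R \<nu> \<in> N" using N(2) by auto
  qed
  have S: "S \<in> sets borel" using assms(4) by simp
  have "emeasure (facet_measure F) S = 0"
    unfolding emeasure_facet_measure(2)[OF assms(1,2) S]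
    using null_sets_subset[OF N(1) _ sub] emeasure_facet_measure(1)[OF assms(1,2) S]
    by (simp add: \<nu>_def null_sets_def)
  then show ?thesis
    using S by (intro AE_I[where N = S]) auto
qed simp


section \<open>Facets of polytopal meshes\<close>

text \<open>By convexity \<open>E\<close> contains the cone with apex \<open>z\<close> over a
  neighbourhood of \<open>x\<close> in \<open>F\<close>; near \<open>x\<close> this cone fills the
  half ball on the side of \<open>z\<close>.\<close>

lemma half_ball_subset_convex:
  fixes E :: "(real^'d) set"
  assumes "convex E" "F \<subseteq> E" "affine hull F = {y. \<nu> \<bullet> y = b}" "x \<in> rel_interior F"
    and "z \<in> E" "\<nu> \<bullet> z < b"
  shows "\<exists>r>0. ball x r \<inter> {y. \<nu> \<bullet> y \<le> b} \<subseteq> E"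
proof -
  obtain e where e: "e > 0" "ball x e \<inter> affine hull F \<subseteq> F" "x \<in> F"
    using assms(4) by (auto simp: mem_rel_interior_ball)
  have xb: "\<nu> \<bullet> x = b" using hull_inc[OF e(3), of affine] assms(3) by simp
  \<comment> \<open>The weight of \<open>z\<close> when \<open>y\<close> is a convex combination of
    \<open>z\<close> and a point of the hyperplane, found by solving \<open>\<nu> \<bullet> y = (1 -
    s y) * b + s y * (\<nu> \<bullet> z)\<close>.\<close>
  define s where "s y = (b - \<nu> \<bullet> y) / (b - \<nu> \<bullet> z)" for y
  \<comment> \<open>the intersection of the line through \<open>z\<close> and \<open>y\<close> with the hyperplane of \<open>F\<close>\<close>
  define f where "f y = (y - s y *\<^sub>R z) /\<^sub>R (1 - s y)" for y
  have s0: "s x = 0" by (simp add: s_def xb)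
  have cs: "continuous_on UNIV s" unfolding s_def using assms(6) by (intro continuous_intros) auto
  have "isCont s x" using cs by (simp add: continuous_on_eq_continuous_at)
  then have "isCont f x" unfolding f_def using s0 by (intro continuous_intros) auto
  moreover have "f x = x" by (simp add: f_def s0)
  ultimately have "(f \<longlongrightarrow> x) (nhds x)" by (metis isCont_def tendsto_at_iff_tendsto_nhds)
  then have "\<forall>\<^sub>F y in nhds x. dist (f y) x < e" using e(1) by (rule tendstoD)
  moreover have "\<forall>\<^sub>F y in nhds x. s y < 1"
    using \<open>isCont s x\<close> s0 by (metis isCont_def order_tendstoD(2) tendsto_at_iff_tendsto_nhds zero_less_one)
  ultimately have "\<forall>\<^sub>F y in nhds x. dist (f y) x < e \<and> s y < 1" by (rule eventually_conj)
  then obtain r where r: "r > 0" "\<And>y. dist y x < r \<Longrightarrow> dist (f y) x < e \<and> s y < 1"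
    unfolding eventually_nhds_metric by blast
  have "y \<in> E" if y: "y \<in> ball x r" "\<nu> \<bullet> y \<le> b" for y
  proof -
    have fy: "dist (f y) x < e" "s y < 1" using r(2)[of y] y by (auto simp: dist_commute)
    have s: "0 \<le> s y" using y assms(6) by (simp add: s_def)
    have "(1 - s y) *\<^sub>R f y = y - s y *\<^sub>R z" using fy by (simp add: f_def)
    then have yf: "y = (1 - s y) *\<^sub>R f y + s y *\<^sub>R z" by simp
    have "\<nu> \<bullet> (y - s y *\<^sub>R z) = (1 - s y) * b"
      using assms(6) by (simp add: inner_diff_right s_def field_simps)
    then have "\<nu> \<bullet> f y = b" using fy by (simp add: f_def)
    then have "f y \<in> F" using e(2) fy(1) assms(3) by (auto simp: dist_commute)
    then have "f y \<in> E" using assms(2) by blast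
    then show ?thesis
      using yf convexD[OF assms(1) _ assms(5), of "f y" "1 - s y" "s y"] s fy by simp
  qed
  then show ?thesis using r(1) by blast
qed

text \<open>The geometric content of a mesh, common to simplices and rectangular elements. Shape
  regularity survives as nonempty interiors. The face property for \<open>E'\<close> is
  \<open>face_mesh\<close> with the cells exchanged.\<close>

locale polytopal_mesh =
  fixes T :: "(real^'d) set set"
  assumes finite_mesh: "finite T"
    and polytope_mesh: "E \<in> T \<Longrightarrow> polytope E"
    and interior_mesh: "E \<in> T \<Longrightarrow> interior E \<noteq> {}"
    and face_mesh: "E \<in> T \<Longrightarrow> E' \<in> T \<Longrightarrow> E \<inter> E' face_of E"
begin

lemma finite_mesh_facets: "finite (mesh_facets T)"
proof -
  have "mesh_facets T = (\<Union>E\<in>T. {F. F facet_of E})" by (auto simp: mesh_facets_def)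
  then show ?thesis using finite_mesh polytope_mesh by (simp add: finite_polytope_facets)
qed

lemma finite_facets_in: "finite (facets_in T S)"
  using finite_mesh_facets by (rule rev_finite_subset) (auto simp: facets_in_def)

lemma mesh_facet:
  assumes "F \<in> mesh_facets T"
  shows "polytope F" "compact F" "aff_dim F = int CARD('d) - 1" "F \<noteq> {}"
proof -
  obtain E where E: "E \<in> T" "F facet_of E" using assms by (auto simp: mesh_facets_def)
  have "aff_dim E = DIM(real^'d)"
    using aff_dim_nonempty_interior interior_mesh[OF E(1)] by blast
  then show "aff_dim F = int CARD('d) - 1" "F \<noteq> {}" using E by (auto simp: facet_of_def)
  show "polytope F" using E polytope_mesh face_of_polytope_polytope by (auto simp: facet_of_def)
  then show "compact F" by (rule polytope_imp_compact)
qed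

lemma mesh_facet_lowdim: "F \<in> mesh_facets T \<Longrightarrow> aff_dim F < int CARD('d)"
  using mesh_facet(3) by simp

text \<open>There are no hanging nodes: the common face of \<open>E\<close> with the cell that owns
  \<open>F\<close> meets the relative interior of \<open>F\<close>, hence contains all of
  \<open>F\<close>.\<close>

lemma face_of_mesh_cell:
  assumes "F \<in> mesh_facets T" "E \<in> T" "x \<in> rel_interior F" "x \<in> E"
  shows "F face_of E"
proof -
  obtain E0 where E0: "E0 \<in> T" "F face_of E0" using assms(1) by (auto simp: mesh_facets_def facet_of_def)
  have "x \<in> F" using assms(3) rel_interior_subset by blast
  then have "F \<subseteq> E0 \<inter> E"
    using assms(3,4) face_of_imp_subset[OF E0(2)]
    by (intro subset_of_face_of[OF face_mesh[OF E0(1) assms(2)]]) auto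
  then have "F face_of (E0 \<inter> E)" using face_of_subset[OF E0(2)] by blast
  moreover have "E0 \<inter> E face_of E" using face_mesh[OF assms(2) E0(1)] by (simp add: Int_commute)
  ultimately show ?thesis by (rule face_of_trans)
qed

text \<open>If the intersection had full facet dimension, both facets would have its affine hull and
  their relative interiors would share a point. Both would then be faces of one cell, and faces of a
  convex set with meeting relative interiors coincide.\<close>

lemma aff_dim_Int_mesh_facets:
  assumes "F \<in> mesh_facets T" "F' \<in> mesh_facets T" "F \<noteq> F'"
  shows "aff_dim (F \<inter> F') < int CARD('d) - 1"
proof (rule ccontr)
  assume *: "\<not> aff_dim (F \<inter> F') < int CARD('d) - 1"
  have conv: "convex F" "convex F'" using assms mesh_facet(1) polytope_imp_convex by blast+
  have d: "aff_dim (F \<inter> F') = aff_dim F" "aff_dim (F \<inter> F') = aff_dim F'"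
    using * mesh_facet(3) assms aff_dim_subset[of "F \<inter> F'" F] by auto
  have ne: "F \<inter> F' \<noteq> {}" using * by (auto simp: aff_dim_empty)
  have "affine hull (F \<inter> F') = affine hull F" "affine hull (F \<inter> F') = affine hull F'"
    using d ne by (intro affine_dim_equal affine_affine_hull hull_mono; simp)+
  then have r: "rel_interior (F \<inter> F') \<subseteq> rel_interior F" "rel_interior (F \<inter> F') \<subseteq> rel_interior F'"
    by (intro subset_rel_interior Int_lower1 Int_lower2; simp)+
  obtain x where x: "x \<in> rel_interior (F \<inter> F')"
    using rel_interior_eq_empty[of "F \<inter> F'"] conv ne by (auto simp: convex_Int)
  obtain E' where E': "E' \<in> T" "F' face_of E'" using assms(2) by (auto simp: mesh_facets_def facet_of_def)
  have "x \<in> E'" using x r rel_interior_subset[of F'] face_of_imp_subset[OF E'(2)] by blast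
  then have "F face_of E'" using face_of_mesh_cell[OF assms(1) E'(1)] x r by blast
  then show False using face_of_eq[of F E' F'] E' x r assms(3) by blast
qed

text \<open>Near \<open>x\<close> each cell contains a half ball bounded by the hyperplane of the
  facet. Two half balls on the same side would make the interiors meet, so the cells lie on opposite
  sides and together contain a ball.\<close>

lemma rel_interior_facet_subset_interior_Un:
  assumes "F \<in> mesh_facets T" "x \<in> rel_interior F"
    and E: "E1 \<in> T" "E2 \<in> T" "interior E1 \<inter> interior E2 = {}" "x \<in> E1" "x \<in> E2"
  shows "x \<in> interior (E1 \<union> E2)"
proof -
  have sub: "F \<subseteq> E1" "F \<subseteq> E2"
    using face_of_mesh_cell[OF assms(1) _ assms(2)] E by (auto dest: face_of_imp_subset)
  have conv: "convex E1" "convex E2" using E polytope_mesh polytope_imp_convex by blast+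
  have "aff_dim F = DIM(real^'d) - 1" using mesh_facet(3)[OF assms(1)] by (simp add: of_nat_diff)
  then obtain \<nu> b where \<nu>: "\<nu> \<noteq> 0" "affine hull F = {y. \<nu> \<bullet> y = b}"
    using aff_dim_eq_hyperplane by blast
  \<comment> \<open>A cell with interior points cannot lie in a hyperplane; the point found here is
    the apex of the cone that yields the half ball.\<close>
  have off: "\<exists>z\<in>E. \<nu> \<bullet> z \<noteq> b" if "E \<in> T" for E
  proof (rule ccontr)
    assume "\<not> (\<exists>z\<in>E. \<nu> \<bullet> z \<noteq> b)"
    then have "interior E \<subseteq> interior {y. \<nu> \<bullet> y = b}" by (intro interior_mono) auto
    then show False using interior_hyperplane[OF \<nu>(1)] interior_mesh[OF that] by auto
  qed
  have xb: "\<nu> \<bullet> x = b" using assms(2) \<nu>(2) rel_interior_subset[of F] hull_subset[of F affine] by blast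
  \<comment> \<open>Stated for an arbitrary half-space so that it applies with \<open>\<nu>\<close>
    and with \<open>- \<nu>\<close>.\<close>
  have disj: False
    if h: "r1 > 0" "ball x r1 \<inter> {y. \<mu> \<bullet> y \<le> c} \<subseteq> E1" "r2 > 0" "ball x r2 \<inter> {y. \<mu> \<bullet> y \<le> c} \<subseteq> E2"
      "\<mu> \<noteq> 0" "\<mu> \<bullet> x = c" for r1 r2 \<mu> c
  proof -
    let ?U = "ball x (min r1 r2) \<inter> {y. \<mu> \<bullet> y < c}"
    \<comment> \<open>A step of half the smaller radius against \<open>\<mu>\<close> stays in both
      balls and strictly inside the half-space.\<close>
    define y where "y = x - (min r1 r2 / (2 * norm \<mu>)) *\<^sub>R \<mu>"
    have "open ?U" by (intro open_Int open_ball open_halfspace_lt)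
    moreover have "?U \<subseteq> E1" "?U \<subseteq> E2" using h by auto
    ultimately have "?U \<subseteq> interior E1 \<inter> interior E2" by (simp add: interior_maximal)
    moreover have "y \<in> ?U"
      using h by (auto simp: y_def dist_norm inner_diff_right)
    ultimately show False using E(3) by blast
  qed
  have opposite: "x \<in> interior (E1 \<union> E2)"
    if h: "r1 > 0" "ball x r1 \<inter> {y. \<mu> \<bullet> y \<le> c} \<subseteq> E1" "r2 > 0" "ball x r2 \<inter> {y. - \<mu> \<bullet> y \<le> - c} \<subseteq> E2"
    for r1 r2 \<mu> c
  proof (rule interiorI[of "ball x (min r1 r2)"])
    show "ball x (min r1 r2) \<subseteq> E1 \<union> E2"
    proof
      fix y assume "y \<in> ball x (min r1 r2)"
      then show "y \<in> E1 \<union> E2" using h by (cases "\<mu> \<bullet> y \<le> c") auto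
    qed
  qed (use h in auto)
  have side: "(\<exists>r>0. ball x r \<inter> {y. \<nu> \<bullet> y \<le> b} \<subseteq> E) \<or> (\<exists>r>0. ball x r \<inter> {y. - \<nu> \<bullet> y \<le> - b} \<subseteq> E)"
    if t: "E \<in> T" "F \<subseteq> E" "convex E" for E
  proof -
    obtain z where z: "z \<in> E" "\<nu> \<bullet> z \<noteq> b" using off[OF t(1)] by blast
    have \<nu>': "affine hull F = {y. - \<nu> \<bullet> y = - b}" using \<nu>(2) by simp
    show ?thesis
    proof (cases "\<nu> \<bullet> z < b")
      case True
      then show ?thesis using half_ball_subset_convex[OF t(3,2) \<nu>(2) assms(2) z(1)] by blast
    next
      case False
      then have "- \<nu> \<bullet> z < - b" using z by simp
      then show ?thesis using half_ball_subset_convex[OF t(3,2) \<nu>' assms(2) z(1)] by blast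
    qed
  qed
  have \<nu>': "- \<nu> \<noteq> 0" "- \<nu> \<bullet> x = - b" using \<nu> xb by auto
  from side[OF E(1) sub(1) conv(1)] side[OF E(2) sub(2) conv(2)] show ?thesis
  proof (elim disjE exE conjE)
    fix r1 r2 assume "0 < r1" "ball x r1 \<inter> {y. \<nu> \<bullet> y \<le> b} \<subseteq> E1" "0 < r2" "ball x r2 \<inter> {y. - \<nu> \<bullet> y \<le> - b} \<subseteq> E2"
    then show ?thesis by (rule opposite)
  next
    fix r1 r2 assume "0 < r1" "ball x r1 \<inter> {y. - \<nu> \<bullet> y \<le> - b} \<subseteq> E1" "0 < r2" "ball x r2 \<inter> {y. \<nu> \<bullet> y \<le> b} \<subseteq> E2"
    then show ?thesis using opposite[where \<mu> = "- \<nu>" and c = "- b"] by simp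
  next
    fix r1 r2 assume "0 < r1" "ball x r1 \<inter> {y. \<nu> \<bullet> y \<le> b} \<subseteq> E1" "0 < r2" "ball x r2 \<inter> {y. \<nu> \<bullet> y \<le> b} \<subseteq> E2"
    then show ?thesis using disj[OF _ _ _ _ \<nu>(1) xb] by blast
  next
    fix r1 r2 assume "0 < r1" "ball x r1 \<inter> {y. - \<nu> \<bullet> y \<le> - b} \<subseteq> E1" "0 < r2" "ball x r2 \<inter> {y. - \<nu> \<bullet> y \<le> - b} \<subseteq> E2"
    then show ?thesis using disj[OF _ _ _ _ \<nu>'] by blast
  qed
qed

text \<open>The relative boundary of a polytope is the union of its finitely many facets, each one
  dimension lower and hence null for the surface measure.\<close>

lemma AE_facet_rel_interior:
  assumes "F \<in> mesh_facets T"
  shows "AE x in facet_measure F. x \<in> rel_interior F"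
proof -
  have fin: "finite {S. S facet_of F}" using mesh_facet(1)[OF assms] by (rule finite_polytope_facets)
  have "AE x in facet_measure F. \<forall>S\<in>{S. S facet_of F}. x \<notin> S"
    unfolding AE_finite_all[OF fin]
  proof (intro ballI AE_facet_measure_not_in_lowdim mesh_facet(2)[OF assms] mesh_facet_lowdim[OF assms])
    fix S assume "S \<in> {S. S facet_of F}"
    then have S: "S facet_of F" by simp
    show "S \<subseteq> F" using S by (rule facet_of_imp_subset)
    show "closed S" using S mesh_facet(1)[OF assms]
      by (meson face_of_polytope_polytope facet_of_imp_face_of polytope_imp_closed)
    show "aff_dim S < int CARD('d) - 1" using S mesh_facet(3)[OF assms] by (simp add: facet_of_def)
  qed
  moreover have "AE x in facet_measure F. x \<in> F"
    using mesh_facet(2) mesh_facet_lowdim assms by (intro AE_facet_measure_in_facet) simp_all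
  ultimately show ?thesis
  proof eventually_elim
    case (elim x)
    then show ?case
      using rel_boundary_of_polyhedron[OF polytope_imp_polyhedron[OF mesh_facet(1)[OF assms]]] by blast
  qed
qed

lemma AE_facet_not_in_other_facets:
  assumes "F \<in> mesh_facets T" "\<F> \<subseteq> mesh_facets T"
  shows "AE x in facet_measure F. x \<in> - \<Union>(\<F> - {F})"
proof -
  have fin: "finite (\<F> - {F})" using assms(2) finite_mesh_facets finite_subset by blast
  have "AE x in facet_measure F. \<forall>F'\<in>\<F> - {F}. x \<notin> F \<inter> F'"
    unfolding AE_finite_all[OF fin]
  proof (intro ballI AE_facet_measure_not_in_lowdim mesh_facet(2)[OF assms(1)] mesh_facet_lowdim[OF assms(1)])
    fix F' assume F': "F' \<in> \<F> - {F}"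
    then show "aff_dim (F \<inter> F') < int CARD('d) - 1"
      using aff_dim_Int_mesh_facets assms by blast
    show "closed (F \<inter> F')"
      using F' assms mesh_facet(2) compact_imp_closed by (intro closed_Int) blast+
  qed simp
  moreover have "AE x in facet_measure F. x \<in> F"
    using mesh_facet(2) mesh_facet_lowdim assms by (intro AE_facet_measure_in_facet) simp_all
  ultimately show ?thesis by eventually_elim blast
qed

end

lemma element_imp_polytope:
  fixes E :: "(real^'d) set"
  assumes "element E" shows "polytope E"
  using assms unfolding element_def
proof
  assume "rectangular E"
  then obtain c and b :: "real^'d" and f :: "real^'d \<Rightarrow> real^'d"
    where "orthogonal_transformation f" "E = (\<lambda>x. c + f x) ` cbox 0 b"
    unfolding rectangular_def by blast
  then have "E = (+) c ` f ` cbox 0 b" "linear f"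
    by (auto simp: image_image orthogonal_transformation_linear)
  then show "polytope E"
    by (simp add: polytope_translation_eq polytope_linear_image polytope_interval)
qed (rule simplex_imp_polytope)

lemma is_mesh_imp_polytopal_mesh:
  assumes "is_mesh \<kappa> G T"
  shows "polytopal_mesh T"
proof
  fix E assume "E \<in> T"
  then have E: "element E" "shape_regular \<kappa> E" using assms unfolding is_mesh_def by auto
  show "polytope E" using E(1) by (rule element_imp_polytope)
  obtain x r where "0 < r" "ball x r \<subseteq> E" using E(2) unfolding shape_regular_def by blast
  then show "interior E \<noteq> {}" by (metis centre_in_ball empty_iff interiorI open_ball)
qed (use assms in \<open>auto simp: is_mesh_def\<close>)


section \<open>Normal traces\<close>

lemma surf_L2_subset: "f \<in> surf_L2 \<F> \<Longrightarrow> \<F>' \<subseteq> \<F> \<Longrightarrow> f \<in> surf_L2 \<F>'"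
  by (auto simp: surf_L2_def)

lemma surf_L2_inner_integrable:
  assumes "f \<in> surf_L2 \<F>" "g \<in> surf_L2 \<F>" "F \<in> \<F>"
  shows "integrable (facet_measure F) (\<lambda>x. f x \<bullet> g x)"
proof (rule Bochner_Integration.integrable_bound)
  show "integrable (facet_measure F) (\<lambda>x. (norm (f x))\<^sup>2 + (norm (g x))\<^sup>2)"
    using assms by (simp add: surf_L2_def)
  have [measurable]: "f \<in> borel_measurable borel" "g \<in> borel_measurable borel"
    using assms by (simp_all add: surf_L2_def)
  show "(\<lambda>x. f x \<bullet> g x) \<in> borel_measurable (facet_measure F)" by measurable
  have "\<bar>f x \<bullet> g x\<bar> \<le> (norm (f x))\<^sup>2 + (norm (g x))\<^sup>2" for x
    by (rule abs_inner_le_sum_squares)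
  then show "AE x in facet_measure F. norm (f x \<bullet> g x) \<le> norm ((norm (f x))\<^sup>2 + (norm (g x))\<^sup>2)"
    by simp
qed

lemma surf_L2_lincomb:
  assumes "f \<in> surf_L2 \<F>" "g \<in> surf_L2 \<F>"
  shows "(\<lambda>x. c *\<^sub>R f x + g x) \<in> surf_L2 \<F>"
proof -
  have [measurable]: "f \<in> borel_measurable borel" "g \<in> borel_measurable borel"
    using assms by (simp_all add: surf_L2_def)
  have "(\<lambda>x. (norm (c *\<^sub>R f x + g x))\<^sup>2)
      = (\<lambda>x. c\<^sup>2 * (f x \<bullet> f x) + 2 * c * (f x \<bullet> g x) + g x \<bullet> g x)"
    unfolding power2_norm_eq_inner inner_add_left inner_add_right
    by (simp add: fun_eq_iff inner_commute power2_eq_square algebra_simps)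
  moreover have "integrable (facet_measure F) \<dots>" if "F \<in> \<F>" for F
    using surf_L2_inner_integrable[OF _ _ that] assms
    by (intro Bochner_Integration.integrable_add integrable_mult_right) simp_all
  ultimately show ?thesis by (simp add: surf_L2_def)
qed

lemma surf_L2_sum:
  assumes "\<And>i. i \<in> I \<Longrightarrow> f i \<in> surf_L2 \<F>"
  shows "(\<lambda>x. \<Sum>i\<in>I. f i x) \<in> surf_L2 \<F>"
  using assms
proof (induction I rule: infinite_finite_induct)
  case (insert i I)
  then show ?case using surf_L2_lincomb[of "f i" \<F> "\<lambda>x. \<Sum>i\<in>I. f i x" 1] by simp
qed (simp_all add: surf_L2_def)

lemma surf_L2_cong_surf_eq:
  assumes "f \<in> borel_measurable borel" "surf_eq \<F> f g" "g \<in> surf_L2 \<F>"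
  shows "f \<in> surf_L2 \<F>"
proof -
  have [measurable]: "f \<in> borel_measurable borel" "g \<in> borel_measurable borel"
    using assms by (simp_all add: surf_L2_def)
  have "integrable (facet_measure F) (\<lambda>x. (norm (f x))\<^sup>2)" if "F \<in> \<F>" for F
  proof (rule integrable_cong_AE_imp)
    show "integrable (facet_measure F) (\<lambda>x. (norm (g x))\<^sup>2)"
      using assms(3) that by (simp add: surf_L2_def)
    show "AE x in facet_measure F. (norm (g x))\<^sup>2 = (norm (f x))\<^sup>2"
      using assms(2) that unfolding surf_eq_def by fastforce
  qed measurable
  then show ?thesis by (simp add: surf_L2_def)
qed

lemma surf_ip_lincomb_left:
  assumes "f \<in> surf_L2 \<F>" "g \<in> surf_L2 \<F>" "h \<in> surf_L2 \<F>"
  shows "surf_ip \<F> (\<lambda>x. c *\<^sub>R f x + g x) h = c * surf_ip \<F> f h + surf_ip \<F> g h"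
proof -
  have "(LINT x|facet_measure F. (c *\<^sub>R f x + g x) \<bullet> h x)
      = c * (LINT x|facet_measure F. f x \<bullet> h x) + (LINT x|facet_measure F. g x \<bullet> h x)"
    if "F \<in> \<F>" for F
    using surf_L2_inner_integrable[OF assms(1,3) that] surf_L2_inner_integrable[OF assms(2,3) that]
    by (simp add: inner_add_left)
  then show ?thesis by (simp add: surf_ip_def sum.distrib sum_distrib_left)
qed

lemma surf_ip_commute: "surf_ip \<F> f g = surf_ip \<F> g f"
  by (simp add: surf_ip_def inner_commute)

lemma is_normal_trace_ntrace:
  "\<exists>t. is_normal_trace T G \<tau> t \<Longrightarrow> is_normal_trace T G \<tau> (ntrace T G \<tau>)"
  unfolding ntrace_def using someI[of "is_normal_trace T G \<tau>"] by auto

lemma is_normal_trace_surf_L2: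
  "is_normal_trace T G \<tau> t \<Longrightarrow> \<F> \<subseteq> facets_in T (frontier G) \<Longrightarrow> t \<in> surf_L2 \<F>"
  unfolding is_normal_trace_def using surf_L2_subset by blast

context polytopal_mesh
begin

lemma surf_L2_continuous:
  fixes \<phi> :: "real^'d \<Rightarrow> real^'d"
  assumes "continuous_on UNIV \<phi>" "\<F> \<subseteq> mesh_facets T"
  shows "\<phi> \<in> surf_L2 \<F>"
proof -
  have [measurable]: "\<phi> \<in> borel_measurable borel"
    using assms(1) by (rule borel_measurable_continuous_onI)
  have "integrable (facet_measure F) (\<lambda>x. (norm (\<phi> x))\<^sup>2)" if "F \<in> \<F>" for F
  proof -
    have F: "F \<in> mesh_facets T" using that assms by blast
    interpret finite_measure "facet_measure F"
      using mesh_facet(2)[OF F] mesh_facet_lowdim[OF F] by (rule finite_measure_facet_measure)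
    have "compact (\<phi> ` F)"
      using mesh_facet(2)[OF F] assms(1) by (intro compact_continuous_image) (auto intro: continuous_on_subset)
    then have "bounded (\<phi> ` F)" by (rule compact_imp_bounded)
    then obtain C where C: "\<And>x. x \<in> F \<Longrightarrow> norm (\<phi> x) \<le> C"
      unfolding bounded_iff by blast
    have "AE x in facet_measure F. x \<in> F"
      using mesh_facet(2)[OF F] mesh_facet_lowdim[OF F] by (rule AE_facet_measure_in_facet)
    then have "AE x in facet_measure F. norm ((norm (\<phi> x))\<^sup>2) \<le> C\<^sup>2"
      by eventually_elim (simp add: C power_mono)
    then show ?thesis by (rule integrable_const_bound) measurable
  qed
  then show ?thesis by (simp add: surf_L2_def)
qed

lemma surf_L2_integrable:
  fixes t :: "real^'d \<Rightarrow> real^'d"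
  assumes "t \<in> surf_L2 \<F>" "\<F> \<subseteq> mesh_facets T" "F \<in> \<F>"
  shows "integrable (facet_measure F) t"
proof -
  have "integrable (facet_measure F) (\<lambda>x. t x \<bullet> b)" for b
    using surf_L2_inner_integrable[OF assms(1) surf_L2_continuous[OF _ assms(2)] assms(3), of "\<lambda>x. b"]
    by simp
  then have "integrable (facet_measure F) (\<lambda>x. \<Sum>b\<in>Basis. (t x \<bullet> b) *\<^sub>R b)"
    by (intro Bochner_Integration.integrable_sum integrable_scaleR_left)
  then show ?thesis unfolding euclidean_representation .
qed

text \<open>Test functions supported away from all facets but one see only that facet, since facets
  overlap in null sets.\<close>

lemma AE_facet_zero_if_integral_test_function_zero:
  fixes d :: "(real^'d) set \<Rightarrow> real^'d \<Rightarrow> real^'d"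
  assumes sub: "\<F> \<subseteq> mesh_facets T" and F: "F \<in> \<F>" and "open U"
    and d: "d F \<in> surf_L2 {F}"
    and test0: "\<And>\<phi>. test_function U \<phi> \<Longrightarrow> (\<Sum>F\<in>\<F>. LINT x|facet_measure F. d F x \<bullet> \<phi> x) = 0"
  shows "AE x in facet_measure F. x \<in> U \<longrightarrow> d F x = 0"
proof -
  let ?U = "U \<inter> - \<Union>(\<F> - {F})"
  have FT: "F \<in> mesh_facets T" using sub F by blast
  have fin: "finite \<F>" using sub finite_mesh_facets finite_subset by blast
  have "closed (\<Union>(\<F> - {F}))"
    using sub mesh_facet(2) fin by (intro closed_Union) (auto intro: compact_imp_closed)
  then have U: "open ?U" using \<open>open U\<close> by blast
  have "AE x in facet_measure F. x \<in> ?U \<longrightarrow> d F x = 0"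
  proof (rule AE_zero_if_integral_test_function_zero[OF _ _ U])
    show "integrable (facet_measure F) (d F)"
      using surf_L2_integrable[OF d] FT by simp
    fix \<phi> :: "real^'d \<Rightarrow> real^'d" assume \<phi>: "test_function ?U \<phi>"
    then obtain K where K: "compact K" "K \<subseteq> ?U" "\<And>x. x \<notin> K \<Longrightarrow> \<phi> x = 0"
      unfolding test_function_def by blast
    have "test_function U \<phi>" using \<phi> unfolding test_function_def by blast
    then have "(\<Sum>F\<in>\<F>. LINT x|facet_measure F. d F x \<bullet> \<phi> x) = 0" by (rule test0)
    moreover have "(LINT x|facet_measure F'. d F' x \<bullet> \<phi> x) = 0" if F': "F' \<in> \<F> - {F}" for F'
    proof -
      have "F' \<in> mesh_facets T" using F' sub by blast
      then have "AE x in facet_measure F'. x \<in> F'"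
        using mesh_facet(2) mesh_facet_lowdim by (intro AE_facet_measure_in_facet) simp_all
      then have "AE x in facet_measure F'. d F' x \<bullet> \<phi> x = 0"
      proof eventually_elim
        case (elim x)
        then have "x \<notin> K" using K(2) F' by blast
        then show ?case using K(3) by simp
      qed
      then show ?thesis by (rule integral_eq_zero_AE)
    qed
    ultimately show "(LINT x|facet_measure F. d F x \<bullet> \<phi> x) = 0"
      using fin F by (simp add: sum.remove)
  qed simp
  moreover have "AE x in facet_measure F. x \<in> - \<Union>(\<F> - {F})"
    using FT sub by (rule AE_facet_not_in_other_facets)
  ultimately show ?thesis by eventually_elim blast
qed

lemma facets_in_subset: "facets_in T S \<subseteq> mesh_facets T"
  by (auto simp: facets_in_def)

text \<open>Green's formula holds for every C1 function, also those not vanishing on the boundary,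
  so the test functions may be taken on the whole space and reach every boundary facet.\<close>

lemma is_normal_trace_unique:
  assumes "is_normal_trace T G \<tau> t" "is_normal_trace T G \<tau> t'"
  shows "surf_eq (facets_in T (frontier G)) t t'"
  unfolding surf_eq_def
proof
  let ?\<F> = "facets_in T (frontier G)"
  fix F assume F: "F \<in> ?\<F>"
  have t: "t \<in> surf_L2 ?\<F>" "t' \<in> surf_L2 ?\<F>"
    using assms by (simp_all add: is_normal_trace_def)
  define d where "d = (\<lambda>x. (-1) *\<^sub>R t' x + t x)"
  have dL: "d \<in> surf_L2 ?\<F>" unfolding d_def using t by (intro surf_L2_lincomb)
  have "AE x in facet_measure F. x \<in> UNIV \<longrightarrow> d x = 0"
  proof (rule AE_facet_zero_if_integral_test_function_zero[OF facets_in_subset F, where d = "\<lambda>_. d"])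
    show "d \<in> surf_L2 {F}" using dL F surf_L2_subset by blast
    fix \<phi> :: "real^'d \<Rightarrow> real^'d" assume "test_function UNIV \<phi>"
    then have C: "C1 \<phi>" by (rule test_function_C1)
    then have "\<phi> \<in> surf_L2 ?\<F>" by (intro surf_L2_continuous C1_continuous facets_in_subset)
    then have "surf_ip ?\<F> d \<phi> = - surf_ip ?\<F> t' \<phi> + surf_ip ?\<F> t \<phi>"
      unfolding d_def using t by (subst surf_ip_lincomb_left) simp_all
    also have "\<dots> = 0" using assms C unfolding is_normal_trace_def by simp
    finally show "(\<Sum>F\<in>?\<F>. LINT x|facet_measure F. d x \<bullet> \<phi> x) = 0" by (simp add: surf_ip_def)
  qed simp
  then show "AE x in facet_measure F. t x = t' x" by eventually_elim (simp add: d_def)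
qed

lemma is_normal_trace_lincomb:
  fixes G :: "(real^'d) set"
  assumes "open G" "bounded G" "\<tau> \<in> Hdiv G" "\<tau>' \<in> Hdiv G"
    and "is_normal_trace T G \<tau> t" "is_normal_trace T G \<tau>' t'"
  shows "is_normal_trace T G (\<lambda>x. c *\<^sub>R \<tau> x + \<tau>' x) (\<lambda>x. c *\<^sub>R t x + t' x)"
  unfolding is_normal_trace_def
proof (intro conjI allI impI)
  let ?\<F> = "facets_in T (frontier G)"
  have t: "t \<in> surf_L2 ?\<F>" "t' \<in> surf_L2 ?\<F>"
    using assms by (simp_all add: is_normal_trace_def)
  then show "(\<lambda>x. c *\<^sub>R t x + t' x) \<in> surf_L2 ?\<F>" by (rule surf_L2_lincomb)
  fix \<phi> :: "real^'d \<Rightarrow> real^'d" assume C: "C1 \<phi>"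
  then have "\<phi> \<in> surf_L2 ?\<F>" by (intro surf_L2_continuous C1_continuous facets_in_subset)
  with t have "surf_ip ?\<F> (\<lambda>x. c *\<^sub>R t x + t' x) \<phi> = c * surf_ip ?\<F> t \<phi> + surf_ip ?\<F> t' \<phi>"
    by (rule surf_ip_lincomb_left)
  then show "green G (\<lambda>x. c *\<^sub>R \<tau> x + \<tau>' x) \<phi> = surf_ip ?\<F> (\<lambda>x. c *\<^sub>R t x + t' x) \<phi>"
    using green_lincomb[OF assms(1-4) C] assms(5,6) C by (simp add: is_normal_trace_def)
qed

end


section \<open>The interface form\<close>

lemma fin_dim_space_lincomb:
  assumes "fin_dim_space S" "f \<in> S" "g \<in> S"
  shows "(\<lambda>x. c *\<^sub>R f x + g x) \<in> S"
proof -
  obtain B where B: "finite B" "S = {f. \<exists>c. f = (\<lambda>x. \<Sum>b\<in>B. c b *\<^sub>R b x)}"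
    using assms(1) unfolding fin_dim_space_def by blast
  obtain c1 where "f = (\<lambda>x. \<Sum>b\<in>B. c1 b *\<^sub>R b x)" using assms(2) B(2) by auto
  moreover obtain c2 where "g = (\<lambda>x. \<Sum>b\<in>B. c2 b *\<^sub>R b x)" using assms(3) B(2) by auto
  ultimately have "(\<lambda>x. c *\<^sub>R f x + g x) = (\<lambda>x. \<Sum>b\<in>B. (c * c1 b + c2 b) *\<^sub>R b x)"
    by (simp add: scaleR_sum_right sum.distrib scaleR_left_distrib)
  then show ?thesis unfolding B(2) by (intro CollectI exI[of _ "\<lambda>b. c * c1 b + c2 b"])
qed

text \<open>Measurability of \<open>A\<close> is given for each fixed matrix only. Expanding
  \<open>\<sigma> x\<close> in a basis and using linearity of \<open>A x\<close> writes the
  composition as a finite sum of products of measurable functions; the uniform upper bound of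
  \<open>A\<close> gives integrability.\<close>

lemma compliance_tensor_L2:
  fixes G H :: "(real^'d) set"
  assumes "compliance_tensor G A" "H \<subseteq> G" "H \<in> sets borel" "\<sigma> \<in> L2 H"
  shows "(\<lambda>x. A x (\<sigma> x)) \<in> L2 H"
proof -
  have lin: "linear (A x)" if "x \<in> H" for x
    using assms(1,2) that unfolding compliance_tensor_def by blast
  obtain a1 where a1: "\<And>x M. x \<in> H \<Longrightarrow> norm (A x M) \<le> a1 * norm M"
    using assms(1,2) unfolding compliance_tensor_def by blast
  have [measurable]: "(\<lambda>x. indicator H x *\<^sub>R A x M) \<in> borel_measurable borel" for M
  proof -
    have [measurable]: "(\<lambda>x. indicator G x *\<^sub>R A x M) \<in> borel_measurable borel" "H \<in> sets borel"
      using assms by (auto simp: compliance_tensor_def set_borel_measurable_indicator)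
    have "(\<lambda>x. indicator H x *\<^sub>R A x M) = (\<lambda>x. indicator H x *\<^sub>R (indicator G x *\<^sub>R A x M))"
      using assms(2) by (auto simp: indicator_def fun_eq_iff)
    moreover have "\<dots> \<in> borel_measurable borel" by measurable
    ultimately show ?thesis by (simp only:)
  qed
  have [measurable]: "(\<lambda>x. indicator H x *\<^sub>R \<sigma> x) \<in> borel_measurable borel"
    using assms(4) by (simp add: L2_def set_borel_measurable_indicator)
  have "indicator H x *\<^sub>R A x (\<sigma> x)
      = (\<Sum>b\<in>Basis. ((indicator H x *\<^sub>R \<sigma> x) \<bullet> b) *\<^sub>R (indicator H x *\<^sub>R A x b))" for x
  proof (cases "x \<in> H")
    case True
    have "A x (\<sigma> x) = A x (\<Sum>b\<in>Basis. (\<sigma> x \<bullet> b) *\<^sub>R b)" by (simp only: euclidean_representation)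
    also have "\<dots> = (\<Sum>b\<in>Basis. (\<sigma> x \<bullet> b) *\<^sub>R A x b)"
      using lin[OF True] by (simp only: linear_sum linear_cmul)
    finally show ?thesis using True by simp
  qed simp
  moreover have "(\<lambda>x. \<Sum>b\<in>Basis. ((indicator H x *\<^sub>R \<sigma> x) \<bullet> b) *\<^sub>R (indicator H x *\<^sub>R A x b))
      \<in> borel_measurable borel"
    by measurable
  ultimately have "set_borel_measurable lborel H (\<lambda>x. A x (\<sigma> x))"
    unfolding set_borel_measurable_indicator by (simp only:)
  then show ?thesis
    by (rule L2_bounded_multiplier[OF assms(4)]) (rule a1)
qed

locale elasticity_decomposition =
  fixes \<kappa> \<beta> :: real
    and \<Omega> \<Gamma>N :: "(real^'d) set"
    and A :: "real^'d \<Rightarrow> real^'d^'d \<Rightarrow> real^'d^'d"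
    and T :: "(real^'d) set set"
    and X :: "'d mfield set" and V :: "'d vfield set" and W :: "'d mfield set"
    and n :: nat and \<Omega>s :: "nat \<Rightarrow> (real^'d) set"
  assumes domain: "polygonal_domain \<Omega>"
    and mesh: "is_mesh \<kappa> \<Omega> T"
    and tensor: "compliance_tensor \<Omega> A"
    and decomp: "decomposition \<kappa> T \<Omega> n \<Omega>s"
    and \<beta>_pos: "0 < \<beta>"
    and stable: "stable_triple \<beta> T \<Omega> \<Gamma>N X V W"
    and stable_sub: "i \<in> {1..n} \<Longrightarrow> stable_triple \<beta> T (\<Omega>s i) \<Gamma>N
           (restr (\<Omega>s i) X) (restr (\<Omega>s i) V) (restr (\<Omega>s i) W)"
    and inf_sup_broken: "inf_sup \<beta> \<Omega> X (broken n \<Omega>s V) (broken n \<Omega>s W)"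
    and traces: "independent_traces T n \<Omega>s X"
begin

sublocale polytopal_mesh T
  using mesh by (rule is_mesh_imp_polytopal_mesh)

lemma domain_props: "open \<Omega>" "bounded \<Omega>" "interior (closure \<Omega>) = \<Omega>" "\<Omega> \<in> sets borel"
  using domain by (auto simp: polygonal_domain_def)

lemma subdomain_props:
  assumes "i \<in> {1..n}"
  shows "open (\<Omega>s i)" "bounded (\<Omega>s i)" "\<Omega>s i \<in> sets borel" "interior (closure (\<Omega>s i)) = \<Omega>s i"
    "closure (\<Omega>s i) = \<Union>{E \<in> T. E \<subseteq> closure (\<Omega>s i)}" "closure (\<Omega>s i) \<subseteq> closure \<Omega>" "\<Omega>s i \<subseteq> \<Omega>"
proof -
  have p: "polygonal_domain (\<Omega>s i)" using decomp assms unfolding decomposition_def by blast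
  then show 1: "open (\<Omega>s i)" "bounded (\<Omega>s i)" "interior (closure (\<Omega>s i)) = \<Omega>s i" "\<Omega>s i \<in> sets borel"
    by (auto simp: polygonal_domain_def)
  show "closure (\<Omega>s i) = \<Union>{E \<in> T. E \<subseteq> closure (\<Omega>s i)}"
    using decomp assms unfolding decomposition_def by blast
  show 2: "closure (\<Omega>s i) \<subseteq> closure \<Omega>"
    using decomp assms unfolding decomposition_def by blast
  show "\<Omega>s i \<subseteq> \<Omega>"
    using interior_mono[OF 2] 1 domain_props by simp
qed

lemma subdomains_disjoint: "i \<in> {1..n} \<Longrightarrow> j \<in> {1..n} \<Longrightarrow> i \<noteq> j \<Longrightarrow> \<Omega>s i \<inter> \<Omega>s j = {}"
  using decomp unfolding decomposition_def by blast

section \<open>Splitting volume integrals over the subdomains\<close>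

lemma interior_cell_subset_subdomain:
  assumes "i \<in> {1..n}" "E \<subseteq> closure (\<Omega>s i)"
  shows "interior E \<subseteq> \<Omega>s i"
  using interior_mono[OF assms(2)] subdomain_props(4)[OF assms(1)] by simp

text \<open>Only the closures of the subdomains cover. A point of \<open>\<Omega>\<close> outside
  all cell boundaries is interior to some cell, and interiors of cells lie in subdomains because
  these have no slits; the cell boundaries are finitely many null sets.\<close>

lemma AE_in_subdomain: "AE x in lborel. x \<in> \<Omega> \<longrightarrow> (\<exists>i\<in>{1..n}. x \<in> \<Omega>s i)"
proof -
  have "frontier E \<in> null_sets lborel" if "E \<in> T" for E
    using that polytope_mesh negligible_convex_frontier polytope_imp_convex
    by (intro negligible_imp_null_sets_lborel) auto
  then have "(\<Union>E\<in>T. frontier E) \<in> null_sets lborel"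
    using finite_mesh by (intro null_sets.finite_UN) auto
  then have "AE x in lborel. x \<notin> (\<Union>E\<in>T. frontier E)" by (rule AE_not_in)
  then show ?thesis
  proof eventually_elim
    case (elim x)
    show ?case
    proof
      assume "x \<in> \<Omega>"
      then have "x \<in> (\<Union>i\<in>{1..n}. closure (\<Omega>s i))"
        using decomp closure_subset unfolding decomposition_def by blast
      then obtain i where i: "i \<in> {1..n}" "x \<in> closure (\<Omega>s i)" by blast
      then obtain E where E: "E \<in> T" "E \<subseteq> closure (\<Omega>s i)" "x \<in> E"
        using subdomain_props(5)[OF i(1)] by blast
      have "x \<in> interior E"
        using elim E closure_subset unfolding frontier_def by blast
      then show "\<exists>i\<in>{1..n}. x \<in> \<Omega>s i" using interior_cell_subset_subdomain i E by blast
    qed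
  qed
qed

lemma indicator_subdomains:
  assumes "i \<in> {1..n}" "x \<in> \<Omega>s i"
  shows "(\<Sum>j\<in>{1..n}. indicator (\<Omega>s j) x *\<^sub>R g j) = (g i :: 'b::real_vector)"
proof -
  have "indicator (\<Omega>s j) x *\<^sub>R g j = (if j = i then g i else 0)" if "j \<in> {1..n}" for j
    using subdomains_disjoint[OF assms(1) that] assms(2) by (auto simp: indicator_def)
  then have "(\<Sum>j\<in>{1..n}. indicator (\<Omega>s j) x *\<^sub>R g j) = (\<Sum>j\<in>{1..n}. if j = i then g i else 0)"
    by (intro sum.cong) auto
  also have "\<dots> = g i" using assms(1) by simp
  finally show ?thesis .
qed

text \<open>Each \<open>g i\<close> is controlled on its own subdomain only. The broken field is
  zero off the subdomains, so the splitting is a pointwise identity of integrands.\<close>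

lemma ip_broken:
  fixes g :: "nat \<Rightarrow> real^'d \<Rightarrow> 'b::euclidean_space"
  assumes "\<And>i. i \<in> {1..n} \<Longrightarrow> g i \<in> L2 (\<Omega>s i)" "\<And>i. i \<in> {1..n} \<Longrightarrow> f \<in> L2 (\<Omega>s i)"
  shows "ip \<Omega> (\<lambda>x. \<Sum>i\<in>{1..n}. indicator (\<Omega>s i) x *\<^sub>R g i x) f = (\<Sum>i\<in>{1..n}. ip (\<Omega>s i) (g i) f)"
proof -
  have e: "indicator \<Omega> x *\<^sub>R ((\<Sum>i\<in>{1..n}. indicator (\<Omega>s i) x *\<^sub>R g i x) \<bullet> f x)
      = (\<Sum>i\<in>{1..n}. indicator (\<Omega>s i) x *\<^sub>R (g i x \<bullet> f x))" for x
  proof (cases "x \<in> \<Omega>")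
    case True then show ?thesis by (simp add: inner_sum_left)
  next
    case False
    then have "x \<notin> \<Omega>s i" if "i \<in> {1..n}" for i using subdomain_props(7)[OF that] by blast
    then show ?thesis using False by simp
  qed
  have "integrable lborel (\<lambda>x. indicator (\<Omega>s i) x *\<^sub>R (g i x \<bullet> f x))" if "i \<in> {1..n}" for i
    using L2_inner_integrable[OF assms(1)[OF that] assms(2)[OF that]] by (simp add: set_integrable_def)
  then show ?thesis
    unfolding ip_def set_lebesgue_integral_def e by (rule Bochner_Integration.integral_sum)
qed

text \<open>Replacing \<open>f\<close> by its broken version changes it on a null set of
  \<open>\<Omega>\<close> only, which reduces the claim to \<open>ip_broken\<close>.\<close>

lemma ip_decompose:
  fixes f g :: "real^'d \<Rightarrow> 'b::euclidean_space"
  assumes "f \<in> L2 \<Omega>" "g \<in> L2 \<Omega>"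
  shows "ip \<Omega> f g = (\<Sum>i\<in>{1..n}. ip (\<Omega>s i) f g)"
proof -
  have L: "f \<in> L2 (\<Omega>s i)" "g \<in> L2 (\<Omega>s i)" if "i \<in> {1..n}" for i
    using assms subdomain_props(3,7)[OF that] L2_subset by blast+
  let ?f = "\<lambda>x. \<Sum>i\<in>{1..n}. indicator (\<Omega>s i) x *\<^sub>R f x"
  have i1: "integrable lborel (\<lambda>x. indicator \<Omega> x *\<^sub>R (f x \<bullet> g x))"
    using L2_inner_integrable[OF assms] by (simp add: set_integrable_def)
  have i2: "(\<lambda>x. indicator \<Omega> x *\<^sub>R (?f x \<bullet> g x)) \<in> borel_measurable lborel"
  proof -
    have "(\<lambda>x. indicator \<Omega> x *\<^sub>R (?f x \<bullet> g x))
        = (\<lambda>x. \<Sum>i\<in>{1..n}. indicator (\<Omega>s i) x * (indicator \<Omega> x *\<^sub>R (f x \<bullet> g x)))" (is "_ = ?h")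
      unfolding inner_sum_left inner_scaleR_left real_scaleR_def sum_distrib_left
      by (simp only: mult.left_commute)
    moreover have "?h \<in> borel_measurable lborel"
      using subdomain_props(3)
      by (intro borel_measurable_sum borel_measurable_times borel_measurable_indicator
          borel_measurable_integrable[OF i1]) simp
    ultimately show ?thesis by (simp only:)
  qed
  have "ip \<Omega> f g = ip \<Omega> ?f g"
    unfolding ip_def set_lebesgue_integral_def
  proof (rule integral_cong_AE)
    show "AE x in lborel. indicator \<Omega> x *\<^sub>R (f x \<bullet> g x) = indicator \<Omega> x *\<^sub>R (?f x \<bullet> g x)"
      using AE_in_subdomain
    proof eventually_elim
      case (elim x)
      show ?case
      proof (cases "x \<in> \<Omega>")
        case True
        then obtain i where "i \<in> {1..n}" "x \<in> \<Omega>s i" using elim by blast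
        then have "?f x = f x" by (rule indicator_subdomains)
        then show ?thesis by (simp only:)
      qed simp
    qed
  qed (use i1 i2 in \<open>simp_all add: borel_measurable_integrable\<close>)
  also have "\<dots> = (\<Sum>i\<in>{1..n}. ip (\<Omega>s i) f g)" using L by (rule ip_broken)
  finally show ?thesis .
qed

subsection \<open>Interfaces\<close>

lemma Gam2_subset: "Gam2 T \<Omega>s i j \<subseteq> facets_in T (frontier (\<Omega>s i))"
  by (auto simp: Gam2_def facets_in_def)

lemma Gam1_subset: "Gam1 T n \<Omega>s i \<subseteq> facets_in T (frontier (\<Omega>s i))"
  using Gam2_subset by (auto simp: Gam1_def)

lemma finite_Gam1: "finite (Gam1 T n \<Omega>s i)"
  using Gam1_subset finite_facets_in by (rule finite_subset)

lemma Gam1_E: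
  assumes "F \<in> Gam1 T n \<Omega>s i"
  obtains j where "j \<in> {1..n}" "j \<noteq> i" "F \<in> mesh_facets T" "F \<subseteq> frontier (\<Omega>s i)" "F \<subseteq> frontier (\<Omega>s j)"
proof -
  obtain j where "j \<in> {1..n} - {i}" "F \<in> Gam2 T \<Omega>s i j" using assms unfolding Gam1_def by blast
  then show ?thesis using that[of j] by (simp add: Gam2_def facets_in_def)
qed

text \<open>For a facet already known to be an interface facet, mere contact with subdomain
  \<open>k\<close> suffices: the second subdomain that \<open>Gam1\<close> asks for is
  \<open>i\<close>, or \<open>k = i\<close> itself. This matches the sums over touching subdomains
  with the sums over interface facets.\<close>

lemma mem_Gam1_iff:
  assumes "F \<in> Gam1 T n \<Omega>s i" "i \<in> {1..n}" "k \<in> {1..n}"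
  shows "F \<in> Gam1 T n \<Omega>s k \<longleftrightarrow> F \<subseteq> frontier (\<Omega>s k)"
proof
  assume k: "F \<subseteq> frontier (\<Omega>s k)"
  obtain j where j: "j \<in> {1..n}" "j \<noteq> i" "F \<in> mesh_facets T" "F \<subseteq> frontier (\<Omega>s i)" "F \<subseteq> frontier (\<Omega>s j)"
    using assms(1) by (rule Gam1_E)
  show "F \<in> Gam1 T n \<Omega>s k"
  proof (cases "k = i")
    case True then show ?thesis using assms(1) by simp
  next
    case False
    then show ?thesis using j k assms(2) by (auto simp: Gam1_def Gam2_def facets_in_def)
  qed
qed (auto elim: Gam1_E)

text \<open>A relative interior point of the facet lies in a cell of each of the two subdomains,
  hence in the interior of their union, and so in the interior of the closure of
  \<open>\<Omega>\<close>, which is \<open>\<Omega>\<close>.\<close>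

lemma AE_interface_in_domain:
  assumes "i \<in> {1..n}" "F \<in> Gam1 T n \<Omega>s i"
  shows "AE x in facet_measure F. x \<in> \<Omega>"
proof -
  obtain j where j: "j \<in> {1..n}" "j \<noteq> i" and F: "F \<in> mesh_facets T"
    "F \<subseteq> frontier (\<Omega>s i)" "F \<subseteq> frontier (\<Omega>s j)"
    using assms(2) by (rule Gam1_E)
  have "AE x in facet_measure F. x \<in> rel_interior F" using F(1) by (rule AE_facet_rel_interior)
  then show ?thesis
  proof eventually_elim
    case (elim x)
    have cell: "\<exists>E\<in>T. E \<subseteq> closure (\<Omega>s k) \<and> x \<in> E" if "k \<in> {1..n}" "F \<subseteq> frontier (\<Omega>s k)" for k
    proof -
      have "x \<in> closure (\<Omega>s k)"
        using elim that(2) rel_interior_subset[of F] by (auto simp: frontier_def)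
      then show ?thesis using subdomain_props(5)[OF that(1)] by blast
    qed
    obtain E1 where E1: "E1 \<in> T" "E1 \<subseteq> closure (\<Omega>s i)" "x \<in> E1" using cell assms(1) F by blast
    obtain E2 where E2: "E2 \<in> T" "E2 \<subseteq> closure (\<Omega>s j)" "x \<in> E2" using cell j F by blast
    have "interior E1 \<inter> interior E2 = {}"
      using interior_cell_subset_subdomain[OF assms(1) E1(2)] interior_cell_subset_subdomain[OF j(1) E2(2)]
        subdomains_disjoint[OF assms(1) j(1)] j(2) by blast
    then have "x \<in> interior (E1 \<union> E2)"
      using rel_interior_facet_subset_interior_Un[OF F(1) elim E1(1) E2(1)] E1 E2 by blast
    moreover have "E1 \<union> E2 \<subseteq> closure \<Omega>"
      using E1 E2 subdomain_props(6)[OF assms(1)] subdomain_props(6)[OF j(1)] by blast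
    ultimately show "x \<in> \<Omega>" using interior_mono[of "E1 \<union> E2"] domain_props(3) by blast
  qed
qed

subsection \<open>Local spaces and traces\<close>

lemma local_space:
  assumes "i \<in> {1..n}" "\<tau> \<in> restr (\<Omega>s i) X"
  shows "\<tau> \<in> Hdiv (\<Omega>s i)" "is_normal_trace T (\<Omega>s i) \<tau> (ntrace T (\<Omega>s i) \<tau>)"
proof -
  have "fe_triple T (\<Omega>s i) \<Gamma>N (restr (\<Omega>s i) X) (restr (\<Omega>s i) V) (restr (\<Omega>s i) W)"
    and t: "\<exists>t. is_normal_trace T (\<Omega>s i) \<tau> t"
    using stable_sub[OF assms(1)] assms(2) unfolding stable_triple_def by blast+
  then show "\<tau> \<in> Hdiv (\<Omega>s i)" using assms(2) unfolding fe_triple_def Hdiv_N_def by blast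
  show "is_normal_trace T (\<Omega>s i) \<tau> (ntrace T (\<Omega>s i) \<tau>)" using t by (rule is_normal_trace_ntrace)
qed

lemma local_L2:
  assumes "i \<in> {1..n}"
  shows "\<tau> \<in> restr (\<Omega>s i) X \<Longrightarrow> \<tau> \<in> L2 (\<Omega>s i)"
    "v \<in> restr (\<Omega>s i) V \<Longrightarrow> v \<in> L2 (\<Omega>s i)"
    "\<xi> \<in> restr (\<Omega>s i) W \<Longrightarrow> \<xi> \<in> L2 (\<Omega>s i)"
  using stable_sub[OF assms] by (auto simp: stable_triple_def fe_triple_def
      intro: local_space(1)[OF assms] Hdiv_imp_L2)

lemma ntrace_surf_L2:
  assumes "i \<in> {1..n}" "\<tau> \<in> restr (\<Omega>s i) X" "\<F> \<subseteq> facets_in T (frontier (\<Omega>s i))"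
  shows "ntrace T (\<Omega>s i) \<tau> \<in> surf_L2 \<F>"
  using local_space(2)[OF assms(1,2)] assms(3) by (rule is_normal_trace_surf_L2)

text \<open>\<open>ntrace\<close> is a choice, so its linearity holds up to null sets: the trace of
  the combination and the combination of the traces are both normal traces of one field.\<close>

lemma local_lincomb:
  assumes "i \<in> {1..n}" "\<tau> \<in> restr (\<Omega>s i) X" "\<tau>' \<in> restr (\<Omega>s i) X"
  shows "(\<lambda>x. c *\<^sub>R \<tau> x + \<tau>' x) \<in> restr (\<Omega>s i) X"
    and "surf_eq (facets_in T (frontier (\<Omega>s i)))
      (ntrace T (\<Omega>s i) (\<lambda>x. c *\<^sub>R \<tau> x + \<tau>' x))
      (\<lambda>x. c *\<^sub>R ntrace T (\<Omega>s i) \<tau> x + ntrace T (\<Omega>s i) \<tau>' x)"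
proof -
  show 1: "(\<lambda>x. c *\<^sub>R \<tau> x + \<tau>' x) \<in> restr (\<Omega>s i) X"
    using stable_sub[OF assms(1)] assms(2,3)
    by (intro fin_dim_space_lincomb) (auto simp: stable_triple_def fe_triple_def)
  show "surf_eq (facets_in T (frontier (\<Omega>s i)))
      (ntrace T (\<Omega>s i) (\<lambda>x. c *\<^sub>R \<tau> x + \<tau>' x))
      (\<lambda>x. c *\<^sub>R ntrace T (\<Omega>s i) \<tau> x + ntrace T (\<Omega>s i) \<tau>' x)"
    by (rule is_normal_trace_unique[OF local_space(2)[OF assms(1) 1]],
        rule is_normal_trace_lincomb)
       (use assms local_space subdomain_props in auto)
qed

abbreviation "\<Lambda> \<equiv> multiplier_space T n \<Omega>s X"

lemma multiplier_E:
  assumes "lam \<in> \<Lambda>" "i \<in> {1..n}" "j \<in> {1..n}" "i \<noteq> j"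
  obtains \<tau> where "\<tau> \<in> restr (\<Omega>s i) X" "surf_eq (Gam2 T \<Omega>s i j) lam (ntrace T (\<Omega>s i) \<tau>)"
proof -
  have "\<exists>\<tau>\<in>restr (\<Omega>s i) X. surf_eq (Gam2 T \<Omega>s i j) lam (ntrace T (\<Omega>s i) \<tau>)"
    using assms by (simp add: multiplier_space_def)
  then show ?thesis using that by blast
qed

text \<open>On different interfaces the multiplier may be the trace of different fields; square
  integrability is a condition on each facet separately, so this does no harm.\<close>

lemma multiplier_surf_L2:
  assumes "lam \<in> \<Lambda>" "i \<in> {1..n}"
  shows "lam \<in> surf_L2 (Gam1 T n \<Omega>s i)"
proof -
  have b: "lam \<in> borel_measurable borel" using assms(1) by (simp add: multiplier_space_def)
  have "lam \<in> surf_L2 (Gam2 T \<Omega>s i j)" if j: "j \<in> {1..n} - {i}" for j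
  proof -
    obtain \<tau> where \<tau>: "\<tau> \<in> restr (\<Omega>s i) X" "surf_eq (Gam2 T \<Omega>s i j) lam (ntrace T (\<Omega>s i) \<tau>)"
      using multiplier_E[OF assms, of j] j by blast
    show ?thesis
      using surf_L2_cong_surf_eq[OF b \<tau>(2)] ntrace_surf_L2[OF assms(2) \<tau>(1) Gam2_subset] by blast
  qed
  then show ?thesis using b by (auto simp: surf_L2_def Gam1_def)
qed

lemma multiplier_lincomb:
  assumes "lam \<in> \<Lambda>" "\<eta> \<in> \<Lambda>"
  shows "(\<lambda>x. c *\<^sub>R lam x + \<eta> x) \<in> \<Lambda>"
  unfolding multiplier_space_def
proof (intro CollectI conjI ballI impI)
  have [measurable]: "lam \<in> borel_measurable borel" "\<eta> \<in> borel_measurable borel"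
    using assms by (simp_all add: multiplier_space_def)
  show "(\<lambda>x. c *\<^sub>R lam x + \<eta> x) \<in> borel_measurable borel" by measurable
  fix i j assume ij: "i \<in> {1..n}" "j \<in> {1..n}" "i \<noteq> j"
  obtain \<tau> where \<tau>: "\<tau> \<in> restr (\<Omega>s i) X" "surf_eq (Gam2 T \<Omega>s i j) lam (ntrace T (\<Omega>s i) \<tau>)"
    using assms(1) ij by (rule multiplier_E)
  obtain \<tau>' where \<tau>': "\<tau>' \<in> restr (\<Omega>s i) X" "surf_eq (Gam2 T \<Omega>s i j) \<eta> (ntrace T (\<Omega>s i) \<tau>')"
    using assms(2) ij by (rule multiplier_E)
  show "\<exists>\<tau>\<in>restr (\<Omega>s i) X. surf_eq (Gam2 T \<Omega>s i j) (\<lambda>x. c *\<^sub>R lam x + \<eta> x) (ntrace T (\<Omega>s i) \<tau>)"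
  proof (intro bexI)
    show "(\<lambda>x. c *\<^sub>R \<tau> x + \<tau>' x) \<in> restr (\<Omega>s i) X" using local_lincomb ij \<tau> \<tau>' by blast
    show "surf_eq (Gam2 T \<Omega>s i j) (\<lambda>x. c *\<^sub>R lam x + \<eta> x)
        (ntrace T (\<Omega>s i) (\<lambda>x. c *\<^sub>R \<tau> x + \<tau>' x))"
      unfolding surf_eq_def
    proof
      fix F assume F: "F \<in> Gam2 T \<Omega>s i j"
      then have "F \<in> facets_in T (frontier (\<Omega>s i))" using Gam2_subset by blast
      with local_lincomb(2)[OF ij(1) \<tau>(1) \<tau>'(1), of c]
      have "AE x in facet_measure F. ntrace T (\<Omega>s i) (\<lambda>x. c *\<^sub>R \<tau> x + \<tau>' x) x
          = c *\<^sub>R ntrace T (\<Omega>s i) \<tau> x + ntrace T (\<Omega>s i) \<tau>' x"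
        unfolding surf_eq_def by blast
      moreover have "AE x in facet_measure F. lam x = ntrace T (\<Omega>s i) \<tau> x"
        "AE x in facet_measure F. \<eta> x = ntrace T (\<Omega>s i) \<tau>' x"
        using \<tau>(2) \<tau>'(2) F unfolding surf_eq_def by blast+
      ultimately show "AE x in facet_measure F. c *\<^sub>R lam x + \<eta> x
          = ntrace T (\<Omega>s i) (\<lambda>x. c *\<^sub>R \<tau> x + \<tau>' x) x"
        by eventually_elim simp
    qed
  qed
qed

section \<open>Restrictions of global fields and cancellation across the interfaces\<close>

definition restriction :: "nat \<Rightarrow> 'd mfield \<Rightarrow> 'd mfield" where
  "restriction i \<tau> = (\<lambda>x. if x \<in> \<Omega>s i then \<tau> x else 0)"

lemma restriction_mem: "\<tau> \<in> X \<Longrightarrow> restriction i \<tau> \<in> restr (\<Omega>s i) X"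
  by (auto simp: restriction_def restr_def)

lemma global_space: "\<tau> \<in> X \<Longrightarrow> \<tau> \<in> Hdiv \<Omega>"
  using stable unfolding stable_triple_def fe_triple_def Hdiv_N_def by blast

lemma has_weak_div_restriction:
  assumes "\<tau> \<in> X" "i \<in> {1..n}"
  shows "has_weak_div (\<Omega>s i) (restriction i \<tau>) (wdiv \<Omega> \<tau>)"
  using has_weak_div_subdomain[OF has_weak_div_wdiv[OF global_space[OF assms(1)]]]
    subdomain_props[OF assms(2)] by (simp add: restriction_def)

lemma ip_wdiv_restriction:
  assumes "\<tau> \<in> X" "i \<in> {1..n}" "v \<in> L2 (\<Omega>s i)"
  shows "ip (\<Omega>s i) v (wdiv (\<Omega>s i) (restriction i \<tau>)) = ip (\<Omega>s i) v (wdiv \<Omega> \<tau>)"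
  using ip_weak_div_eq_wdiv[OF subdomain_props(1,2)[OF assms(2)]
      local_space(1)[OF assms(2) restriction_mem[OF assms(1)]] has_weak_div_restriction[OF assms(1,2)] assms(3)]
  by (simp add: ip_commute)

text \<open>Green's functional consists of volume integrals, so it is additive over the subdomains.
  Interface contributions appear only when each summand is rewritten through its own normal
  trace.\<close>

lemma green_decompose:
  assumes "\<tau> \<in> X" "C1 \<phi>"
  shows "green \<Omega> \<tau> \<phi> = (\<Sum>i\<in>{1..n}. green (\<Omega>s i) (restriction i \<tau>) \<phi>)"
proof -
  have L: "grad \<phi> \<in> L2 \<Omega>" "\<phi> \<in> L2 \<Omega>"
    using assms(2) domain_props by (auto intro!: L2_continuous intro: continuous_on_grad C1_continuous)
  have "green (\<Omega>s i) (restriction i \<tau>) \<phi> = ip (\<Omega>s i) \<tau> (grad \<phi>) + ip (\<Omega>s i) (wdiv \<Omega> \<tau>) \<phi>"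
    if i: "i \<in> {1..n}" for i
  proof -
    have "\<phi> \<in> L2 (\<Omega>s i)" using L subdomain_props(3,7)[OF i] L2_subset by blast
    then have "ip (\<Omega>s i) (wdiv (\<Omega>s i) (restriction i \<tau>)) \<phi> = ip (\<Omega>s i) (wdiv \<Omega> \<tau>) \<phi>"
      using ip_wdiv_restriction[OF assms(1) i] by (simp add: ip_commute)
    moreover have "ip (\<Omega>s i) (restriction i \<tau>) (grad \<phi>) = ip (\<Omega>s i) \<tau> (grad \<phi>)"
      by (rule ip_cong) (simp add: restriction_def)
    ultimately show ?thesis by (simp add: green_def)
  qed
  then show ?thesis
    using global_space[OF assms(1)] L
    by (simp add: green_def ip_decompose wdiv_L2 Hdiv_imp_L2 sum.distrib)
qed

text \<open>Green's formula on \<open>\<Omega>\<close> and on the subdomains, tested with functions supported in \<open>\<Omega>\<close>,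
  shows that the outward normal traces of a global field from the two sides cancel.\<close>

lemma normal_traces_cancel:
  assumes "\<tau> \<in> X" "i \<in> {1..n}" "F \<in> Gam1 T n \<Omega>s i"
  shows "AE x in facet_measure F.
    (\<Sum>k | k \<in> {1..n} \<and> F \<subseteq> frontier (\<Omega>s k). ntrace T (\<Omega>s k) (restriction k \<tau>) x) = 0"
proof -
  define t where "t k = ntrace T (\<Omega>s k) (restriction k \<tau>)" for k
  \<comment> \<open>The set of touching subdomains varies with the facet, so the field to be shown
    zero does too.\<close>
  define D where "D F x = (\<Sum>k | k \<in> {1..n} \<and> F \<subseteq> frontier (\<Omega>s k). t k x)" for F x
  have tr: "is_normal_trace T (\<Omega>s k) (restriction k \<tau>) (t k)" if "k \<in> {1..n}" for k
    unfolding t_def using local_space(2)[OF that restriction_mem[OF assms(1)]] .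
  have tL: "t k \<in> surf_L2 {F}" if "k \<in> {1..n}" "F \<in> mesh_facets T" "F \<subseteq> frontier (\<Omega>s k)" for k F
    using is_normal_trace_surf_L2[OF tr[OF that(1)]] that(2,3) by (simp add: facets_in_def)
  have F: "F \<in> mesh_facets T" using assms(3) by (rule Gam1_E)
  have "AE x in facet_measure F. x \<in> \<Omega> \<longrightarrow> D F x = 0"
  proof (rule AE_facet_zero_if_integral_test_function_zero[OF order.refl F domain_props(1)])
    show "D F \<in> surf_L2 {F}"
      unfolding D_def using tL F by (intro surf_L2_sum) auto
    fix \<phi> :: "real^'d \<Rightarrow> real^'d" assume \<phi>: "test_function \<Omega> \<phi>"
    then have C: "C1 \<phi>" by (rule test_function_C1)
    have "(LINT x|facet_measure F. D F x \<bullet> \<phi> x)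
        = (\<Sum>k | k \<in> {1..n} \<and> F \<subseteq> frontier (\<Omega>s k). LINT x|facet_measure F. t k x \<bullet> \<phi> x)"
      if "F \<in> mesh_facets T" for F
      unfolding D_def inner_sum_left
    proof (rule Bochner_Integration.integral_sum)
      fix k assume "k \<in> {k. k \<in> {1..n} \<and> F \<subseteq> frontier (\<Omega>s k)}"
      then have "t k \<in> surf_L2 {F}" using tL that by blast
      moreover have "\<phi> \<in> surf_L2 {F}" using that C by (intro surf_L2_continuous C1_continuous) auto
      ultimately show "integrable (facet_measure F) (\<lambda>x. t k x \<bullet> \<phi> x)"
        by (rule surf_L2_inner_integrable) simp
    qed
    then have "(\<Sum>F\<in>mesh_facets T. LINT x|facet_measure F. D F x \<bullet> \<phi> x)
        = (\<Sum>F\<in>mesh_facets T. \<Sum>k | k \<in> {1..n} \<and> F \<subseteq> frontier (\<Omega>s k). LINT x|facet_measure F. t k x \<bullet> \<phi> x)"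
      by simp
    \<comment> \<open>Exchanging the sums collects, for each subdomain, all facets of its boundary,
      which is the surface side of its Green's formula.\<close>
    also have "\<dots> = (\<Sum>k\<in>{1..n}. \<Sum>F | F \<in> mesh_facets T \<and> F \<subseteq> frontier (\<Omega>s k). LINT x|facet_measure F. t k x \<bullet> \<phi> x)"
      using finite_mesh_facets by (rule sum.swap_restrict) simp
    also have "\<dots> = (\<Sum>k\<in>{1..n}. green (\<Omega>s k) (restriction k \<tau>) \<phi>)"
      using tr C by (intro sum.cong refl) (simp add: is_normal_trace_def surf_ip_def facets_in_def)
    also have "\<dots> = green \<Omega> \<tau> \<phi>" using green_decompose[OF assms(1) C] by simp
    \<comment> \<open>For a test function supported in \<open>\<Omega>\<close>, vanishing of Green's
      functional is the definition of the weak divergence.\<close>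
    also have "\<dots> = 0"
      using has_weak_div_wdiv[OF global_space[OF assms(1)]] \<phi> by (simp add: green_def has_weak_div_def)
    finally show "(\<Sum>F\<in>mesh_facets T. LINT x|facet_measure F. D F x \<bullet> \<phi> x) = 0" .
  qed
  moreover have "AE x in facet_measure F. x \<in> \<Omega>" using assms(2,3) by (rule AE_interface_in_domain)
  ultimately show ?thesis by eventually_elim (simp add: D_def t_def)
qed

text \<open>The multiplier has one value on both sides of a facet, so it factors out of the sum of
  the outward traces from the touching subdomains, which is zero.\<close>

lemma sum_surf_ip_restriction_zero:
  assumes "\<tau> \<in> X" "lam \<in> \<Lambda>"
  shows "(\<Sum>i\<in>{1..n}. surf_ip (Gam1 T n \<Omega>s i) lam (ntrace T (\<Omega>s i) (restriction i \<tau>))) = 0"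
proof -
  define t where "t k = ntrace T (\<Omega>s k) (restriction k \<tau>)" for k
  have tL: "t k \<in> surf_L2 (Gam1 T n \<Omega>s k)" if "k \<in> {1..n}" for k
    unfolding t_def using that by (intro ntrace_surf_L2 restriction_mem assms(1) Gam1_subset)
  have Gam1: "Gam1 T n \<Omega>s i = {F \<in> mesh_facets T. F \<in> Gam1 T n \<Omega>s i}" for i
    by (auto elim: Gam1_E)
  have "(\<Sum>i\<in>{1..n}. surf_ip (Gam1 T n \<Omega>s i) lam (t i))
      = (\<Sum>i\<in>{1..n}. \<Sum>F | F \<in> mesh_facets T \<and> F \<in> Gam1 T n \<Omega>s i. LINT x|facet_measure F. lam x \<bullet> t i x)"
    unfolding surf_ip_def using Gam1 by simp
  also have "\<dots> = (\<Sum>F\<in>mesh_facets T. \<Sum>i | i \<in> {1..n} \<and> F \<in> Gam1 T n \<Omega>s i. LINT x|facet_measure F. lam x \<bullet> t i x)"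
    by (rule sum.swap_restrict) (use finite_mesh_facets in simp_all)
  also have "\<dots> = 0"
  proof (rule sum.neutral, rule ballI)
    fix F assume "F \<in> mesh_facets T"
    show "(\<Sum>i | i \<in> {1..n} \<and> F \<in> Gam1 T n \<Omega>s i. LINT x|facet_measure F. lam x \<bullet> t i x) = 0"
    proof (cases "\<exists>i\<in>{1..n}. F \<in> Gam1 T n \<Omega>s i")
      case True
      then obtain i where i: "i \<in> {1..n}" "F \<in> Gam1 T n \<Omega>s i" by blast
      have eq: "{k. k \<in> {1..n} \<and> F \<subseteq> frontier (\<Omega>s k)} = {k. k \<in> {1..n} \<and> F \<in> Gam1 T n \<Omega>s k}"
        using mem_Gam1_iff[OF i(2,1)] by auto
      have "(\<Sum>k | k \<in> {1..n} \<and> F \<in> Gam1 T n \<Omega>s k. LINT x|facet_measure F. lam x \<bullet> t k x)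
          = (LINT x|facet_measure F. (\<Sum>k | k \<in> {1..n} \<and> F \<in> Gam1 T n \<Omega>s k. lam x \<bullet> t k x))"
        using surf_L2_inner_integrable[OF multiplier_surf_L2[OF assms(2)] tL]
        by (intro Bochner_Integration.integral_sum[symmetric]) auto
      also have "\<dots> = 0"
      proof (rule integral_eq_zero_AE)
        show "AE x in facet_measure F. (\<Sum>k | k \<in> {1..n} \<and> F \<in> Gam1 T n \<Omega>s k. lam x \<bullet> t k x) = 0"
          using normal_traces_cancel[OF assms(1) i, unfolded eq]
          by eventually_elim (simp add: inner_sum_right[symmetric] t_def)
      qed
      finally show ?thesis .
    next
      case False
      then have "{i. i \<in> {1..n} \<and> F \<in> Gam1 T n \<Omega>s i} = {}" by blast
      then show ?thesis by (simp only: sum.empty)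
    qed
  qed
  finally show ?thesis by (simp add: t_def)
qed

subsection \<open>Symmetry and definiteness\<close>

text \<open>The local fields, glued together, are admissible in the broken inf-sup condition. By
  \<open>orth\<close> its right-hand side is zero for every test field, so both norms vanish, and a
  sum of nonnegative local squares can vanish only termwise.\<close>

lemma broken_fields_zero:
  assumes u: "\<And>i. i \<in> {1..n} \<Longrightarrow> u i \<in> restr (\<Omega>s i) V"
    and \<gamma>: "\<And>i. i \<in> {1..n} \<Longrightarrow> \<gamma> i \<in> restr (\<Omega>s i) W"
    and orth: "\<And>\<tau>. \<tau> \<in> X \<Longrightarrow>
      (\<Sum>i\<in>{1..n}. ip (\<Omega>s i) (u i) (wdiv \<Omega> \<tau>) + ip (\<Omega>s i) (\<gamma> i) \<tau>) = 0"
    and i: "i \<in> {1..n}"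
  shows "ip (\<Omega>s i) (u i) (u i) = 0" "ip (\<Omega>s i) (\<gamma> i) (\<gamma> i) = 0"
proof -
  let ?u = "\<lambda>x. \<Sum>i\<in>{1..n}. indicator (\<Omega>s i) x *\<^sub>R u i x"
  let ?\<gamma> = "\<lambda>x. \<Sum>i\<in>{1..n}. indicator (\<Omega>s i) x *\<^sub>R \<gamma> i x"
  have uL: "u i \<in> L2 (\<Omega>s i)" and \<gamma>L: "\<gamma> i \<in> L2 (\<Omega>s i)" if "i \<in> {1..n}" for i
    using local_L2[OF that] u \<gamma> that by blast+
  \<comment> \<open>Local fields are extended by zero, whereas \<open>broken\<close> is built from
    members of \<open>S\<close> themselves; the indicators make the two indistinguishable.\<close>
  have br: "(\<lambda>x. \<Sum>i\<in>{1..n}. indicator (\<Omega>s i) x *\<^sub>R w i x) \<in> broken n \<Omega>s S"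
    if w: "\<And>i. i \<in> {1..n} \<Longrightarrow> w i \<in> restr (\<Omega>s i) S" for w S
  proof -
    have "\<forall>i\<in>{1..n}. \<exists>g. g \<in> S \<and> w i = (\<lambda>x. if x \<in> \<Omega>s i then g x else 0)"
    proof
      fix i assume "i \<in> {1..n}"
      from w[OF this] show "\<exists>g. g \<in> S \<and> w i = (\<lambda>x. if x \<in> \<Omega>s i then g x else 0)"
        unfolding restr_def by blast
    qed
    then obtain g where g: "\<forall>i\<in>{1..n}. g i \<in> S \<and> w i = (\<lambda>x. if x \<in> \<Omega>s i then g i x else 0)"
      by (auto simp: bchoice_iff)
    then have "indicator (\<Omega>s i) x *\<^sub>R w i x = indicator (\<Omega>s i) x *\<^sub>R g i x" if "i \<in> {1..n}" for i x
      using that by (simp add: indicator_def)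
    then have "(\<lambda>x. \<Sum>i\<in>{1..n}. indicator (\<Omega>s i) x *\<^sub>R w i x)
        = (\<lambda>x. \<Sum>i\<in>{1..n}. indicator (\<Omega>s i) x *\<^sub>R g i x)"
      by (intro ext sum.cong) auto
    then show ?thesis unfolding broken_def using g by blast
  qed
  have sq: "ip \<Omega> (\<lambda>x. \<Sum>i\<in>{1..n}. indicator (\<Omega>s i) x *\<^sub>R w i x) (\<lambda>x. \<Sum>i\<in>{1..n}. indicator (\<Omega>s i) x *\<^sub>R w i x)
      = (\<Sum>i\<in>{1..n}. ip (\<Omega>s i) (w i) (w i))"
    if w: "\<And>i. i \<in> {1..n} \<Longrightarrow> w i \<in> L2 (\<Omega>s i)" for w :: "nat \<Rightarrow> real^'d \<Rightarrow> 'b::euclidean_space"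
  proof -
    let ?w = "\<lambda>x. \<Sum>i\<in>{1..n}. indicator (\<Omega>s i) x *\<^sub>R w i x"
    have e: "?w x = w i x" if "i \<in> {1..n}" "x \<in> \<Omega>s i" for i x
      using indicator_subdomains[OF that, of "\<lambda>i. w i x"] .
    have "?w \<in> L2 (\<Omega>s i)" if "i \<in> {1..n}" for i
      using L2_cong[of "\<Omega>s i" ?w "w i"] e that w by blast
    then have "ip \<Omega> ?w ?w = (\<Sum>i\<in>{1..n}. ip (\<Omega>s i) (w i) ?w)"
      using w by (intro ip_broken)
    also have "\<dots> = (\<Sum>i\<in>{1..n}. ip (\<Omega>s i) (w i) (w i))"
      using e by (intro sum.cong refl ip_cong) simp
    finally show ?thesis .
  qed
  obtain \<tau> where \<tau>: "\<tau> \<in> X" "\<beta> * (l2norm \<Omega> ?u + l2norm \<Omega> ?\<gamma>) \<le> ip \<Omega> ?u (wdiv \<Omega> \<tau>) + ip \<Omega> ?\<gamma> \<tau>"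
    using inf_sup_broken br[of u V] br[of \<gamma> W] u \<gamma> unfolding inf_sup_def by meson
  have L: "wdiv \<Omega> \<tau> \<in> L2 (\<Omega>s i)" "\<tau> \<in> L2 (\<Omega>s i)" if "i \<in> {1..n}" for i
    using global_space[OF \<tau>(1)] wdiv_L2 Hdiv_imp_L2 subdomain_props(3,7)[OF that] L2_subset by blast+
  have "ip \<Omega> ?u (wdiv \<Omega> \<tau>) = (\<Sum>i\<in>{1..n}. ip (\<Omega>s i) (u i) (wdiv \<Omega> \<tau>))"
    using uL L(1) by (rule ip_broken)
  moreover have "ip \<Omega> ?\<gamma> \<tau> = (\<Sum>i\<in>{1..n}. ip (\<Omega>s i) (\<gamma> i) \<tau>)"
    using \<gamma>L L(2) by (rule ip_broken)
  ultimately have "ip \<Omega> ?u (wdiv \<Omega> \<tau>) + ip \<Omega> ?\<gamma> \<tau> = 0"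
    using orth[OF \<tau>(1)] by (simp only: sum.distrib)
  then have "\<beta> * (l2norm \<Omega> ?u + l2norm \<Omega> ?\<gamma>) \<le> 0" using \<tau>(2) by simp
  then have "l2norm \<Omega> ?u + l2norm \<Omega> ?\<gamma> \<le> 0" using \<beta>_pos by (simp add: mult_le_0_iff)
  moreover have "l2norm \<Omega> ?u \<ge> 0" "l2norm \<Omega> ?\<gamma> \<ge> 0" by (simp_all add: l2norm_def ip_nonneg)
  ultimately have "l2norm \<Omega> ?u = 0" "l2norm \<Omega> ?\<gamma> = 0" by linarith+
  then have "ip \<Omega> ?u ?u = 0" "ip \<Omega> ?\<gamma> ?\<gamma> = 0" unfolding l2norm_def real_sqrt_eq_0_iff .
  moreover have "ip \<Omega> ?u ?u = (\<Sum>i\<in>{1..n}. ip (\<Omega>s i) (u i) (u i))" using uL by (rule sq)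
  moreover have "ip \<Omega> ?\<gamma> ?\<gamma> = (\<Sum>i\<in>{1..n}. ip (\<Omega>s i) (\<gamma> i) (\<gamma> i))" using \<gamma>L by (rule sq)
  ultimately have "(\<Sum>i\<in>{1..n}. ip (\<Omega>s i) (u i) (u i)) = 0" "(\<Sum>i\<in>{1..n}. ip (\<Omega>s i) (\<gamma> i) (\<gamma> i)) = 0"
    by (simp_all only:)
  then show "ip (\<Omega>s i) (u i) (u i) = 0" "ip (\<Omega>s i) (\<gamma> i) (\<gamma> i) = 0"
    using i by (simp_all add: sum_nonneg_eq_0_iff ip_nonneg)
qed

text \<open>A multiplier need not be given as the trace of a single local field on all of its
  interfaces. Independence of traces supplies a test field whose trace is \<open>lam\<close> on one
  chosen interface and zero on the others, so orthogonality makes the square of \<open>lam\<close>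
  integrate to zero there.\<close>

lemma multiplier_zero_if_orthogonal:
  assumes lam: "lam \<in> \<Lambda>" and i: "i \<in> {1..n}"
    and orth: "\<And>\<tau>. \<tau> \<in> restr (\<Omega>s i) X \<Longrightarrow> surf_ip (Gam1 T n \<Omega>s i) lam (ntrace T (\<Omega>s i) \<tau>) = 0"
  shows "surf_eq (Gam1 T n \<Omega>s i) lam (\<lambda>x. 0)"
proof -
  have "AE x in facet_measure F. lam x = 0" if j: "j \<in> {1..n} - {i}" and F: "F \<in> Gam2 T \<Omega>s i j" for j F
  proof -
    obtain \<tau> where \<tau>: "\<tau> \<in> restr (\<Omega>s i) X" "surf_eq (Gam2 T \<Omega>s i j) lam (ntrace T (\<Omega>s i) \<tau>)"
      using multiplier_E[OF lam i, of j] j by blast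
    have ij: "j \<in> {1..n}" "i \<noteq> j" using j by auto
    obtain \<tau>' where \<tau>': "\<tau>' \<in> restr (\<Omega>s i) X"
      "surf_eq (Gam2 T \<Omega>s i j) (ntrace T (\<Omega>s i) \<tau>') (ntrace T (\<Omega>s i) \<tau>)"
      "\<And>k. k \<in> {1..n} - {i, j} \<Longrightarrow> surf_eq (Gam2 T \<Omega>s i k) (ntrace T (\<Omega>s i) \<tau>') (\<lambda>x. 0)"
      using bspec[OF mp[OF bspec[OF bspec[OF traces[unfolded independent_traces_def] i] ij(1)] ij(2)] \<tau>(1)]
      by blast
    define t where "t = ntrace T (\<Omega>s i) \<tau>'"
    have FG: "F \<in> Gam1 T n \<Omega>s i" using F j by (auto simp: Gam1_def)
    have lamL: "lam \<in> surf_L2 (Gam1 T n \<Omega>s i)" using lam i by (rule multiplier_surf_L2)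
    have tL: "t \<in> surf_L2 (Gam1 T n \<Omega>s i)"
      unfolding t_def by (rule ntrace_surf_L2[OF i \<tau>'(1) Gam1_subset])
    have same: "AE x in facet_measure F'. t x = lam x" if "F' \<in> Gam2 T \<Omega>s i j" for F'
    proof -
      have "AE x in facet_measure F'. t x = ntrace T (\<Omega>s i) \<tau> x"
        "AE x in facet_measure F'. lam x = ntrace T (\<Omega>s i) \<tau> x"
        using \<tau>(2) \<tau>'(2) that by (auto simp: surf_eq_def t_def)
      then show ?thesis by eventually_elim simp
    qed
    \<comment> \<open>The definitions let one facet occur in several \<open>Gam2\<close>, so the
      chosen interface is tried first: there the integrand is the square of \<open>lam\<close>, and
      on all remaining facets it is zero.\<close>
    have nonneg: "AE x in facet_measure F'. 0 \<le> lam x \<bullet> t x" if F': "F' \<in> Gam1 T n \<Omega>s i" for F'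
    proof (cases "F' \<in> Gam2 T \<Omega>s i j")
      case True
      show ?thesis using same[OF True] by eventually_elim simp
    next
      case False
      then obtain k where "k \<in> {1..n} - {i, j}" "F' \<in> Gam2 T \<Omega>s i k"
        using F' unfolding Gam1_def by blast
      then have "AE x in facet_measure F'. t x = 0" using \<tau>'(3) by (auto simp: surf_eq_def t_def)
      then show ?thesis by eventually_elim simp
    qed
    have "(\<Sum>F\<in>Gam1 T n \<Omega>s i. LINT x|facet_measure F. lam x \<bullet> t x) = 0"
      using orth[OF \<tau>'(1)] by (simp add: surf_ip_def t_def)
    then have "(LINT x|facet_measure F. lam x \<bullet> t x) = 0"
      using FG finite_Gam1 nonneg by (simp add: sum_nonneg_eq_0_iff integral_nonneg_AE)
    then have "AE x in facet_measure F. lam x \<bullet> t x = 0"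
      using integral_nonneg_eq_0_iff_AE[OF surf_L2_inner_integrable[OF lamL tL FG] nonneg[OF FG]] by simp
    with same[OF F] show ?thesis by eventually_elim simp
  qed
  then show ?thesis by (auto simp: surf_eq_def Gam1_def)
qed

end

section \<open>The form built from the local solutions\<close>

locale interface_problem = elasticity_decomposition +
  fixes \<sigma>s :: "nat \<Rightarrow> 'a vfield \<Rightarrow> 'a mfield"
    and us :: "nat \<Rightarrow> 'a vfield \<Rightarrow> 'a vfield"
    and \<gamma>s :: "nat \<Rightarrow> 'a vfield \<Rightarrow> 'a mfield"
  assumes solution: "i \<in> {1..n} \<Longrightarrow> lam \<in> \<Lambda> \<Longrightarrow>
    local_solution T n \<Omega>s A X V W i lam (\<sigma>s i lam) (us i lam) (\<gamma>s i lam)"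
begin

text \<open>The stress for \<open>lam\<close> is a legitimate test field in the first equation for
  \<open>\<eta>\<close>. Its own constraints, zero discrete divergence and weak symmetry, remove the
  displacement and rotation terms.\<close>

lemma subdomain_form_eq:
  assumes i: "i \<in> {1..n}" and "lam \<in> \<Lambda>" "\<eta> \<in> \<Lambda>"
  shows "subdomain_form T n \<Omega>s \<sigma>s i lam \<eta> = ip (\<Omega>s i) (\<lambda>x. A x (\<sigma>s i \<eta> x)) (\<sigma>s i lam)"
proof -
  note l = solution[OF i assms(2), unfolded local_solution_def]
    and e = solution[OF i assms(3), unfolded local_solution_def]
  have "ip (\<Omega>s i) (us i \<eta>) (wdiv (\<Omega>s i) (\<sigma>s i lam)) = 0" "ip (\<Omega>s i) (\<gamma>s i \<eta>) (\<sigma>s i lam) = 0"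
    using l e ip_commute by metis+
  moreover have "ip (\<Omega>s i) (\<lambda>x. A x (\<sigma>s i \<eta> x)) (\<sigma>s i lam) + ip (\<Omega>s i) (us i \<eta>) (wdiv (\<Omega>s i) (\<sigma>s i lam))
      + ip (\<Omega>s i) (\<gamma>s i \<eta>) (\<sigma>s i lam) = surf_ip (Gam1 T n \<Omega>s i) \<eta> (ntrace T (\<Omega>s i) (\<sigma>s i lam))"
    using l e by blast
  ultimately show ?thesis by (simp add: subdomain_form_def surf_ip_commute)
qed

lemma interface_form_symmetric:
  assumes "lam \<in> \<Lambda>" "\<eta> \<in> \<Lambda>"
  shows "interface_form T n \<Omega>s \<sigma>s lam \<eta> = interface_form T n \<Omega>s \<sigma>s \<eta> lam"
  unfolding interface_form_def
proof (rule sum.cong[OF refl])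
  fix i assume i: "i \<in> {1..n}"
  have "A x M \<bullet> N = A x N \<bullet> M" if "x \<in> \<Omega>s i" for x M N
    using tensor that subdomain_props(7)[OF i] unfolding compliance_tensor_def
    by (metis inner_commute subsetD)
  then show "subdomain_form T n \<Omega>s \<sigma>s i lam \<eta> = subdomain_form T n \<Omega>s \<sigma>s i \<eta> lam"
    unfolding subdomain_form_eq[OF i assms] subdomain_form_eq[OF i assms(2,1)] by (rule ip_cong)
qed

lemma interface_form_lincomb_right:
  assumes "f \<in> \<Lambda>" "g \<in> \<Lambda>" "h \<in> \<Lambda>"
  shows "interface_form T n \<Omega>s \<sigma>s h (\<lambda>x. c *\<^sub>R f x + g x)
    = c * interface_form T n \<Omega>s \<sigma>s h f + interface_form T n \<Omega>s \<sigma>s h g"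
proof -
  have "subdomain_form T n \<Omega>s \<sigma>s i h (\<lambda>x. c *\<^sub>R f x + g x)
      = c * subdomain_form T n \<Omega>s \<sigma>s i h f + subdomain_form T n \<Omega>s \<sigma>s i h g" if i: "i \<in> {1..n}" for i
  proof -
    have "\<sigma>s i h \<in> restr (\<Omega>s i) X" using solution[OF i assms(3)] by (simp add: local_solution_def)
    then have t: "ntrace T (\<Omega>s i) (\<sigma>s i h) \<in> surf_L2 (Gam1 T n \<Omega>s i)"
      using i by (intro ntrace_surf_L2 Gam1_subset)
    show ?thesis
      unfolding subdomain_form_def surf_ip_commute[of _ "ntrace T (\<Omega>s i) (\<sigma>s i h)"]
      using multiplier_surf_L2[OF assms(1) i] multiplier_surf_L2[OF assms(2) i] t
      by (rule surf_ip_lincomb_left)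
  qed
  then show ?thesis by (simp add: interface_form_def sum.distrib sum_distrib_left)
qed

text \<open>The maps \<open>\<sigma>s\<close> are only assumed to pick solutions, not to be linear
  in the multiplier. The second argument enters through a surface integral and is linear at once;
  symmetry carries this over to the first argument.\<close>

lemma interface_form_bilinear: "bilinear_form_on \<Lambda> (interface_form T n \<Omega>s \<sigma>s)"
  unfolding bilinear_form_on_def
proof (intro ballI allI conjI)
  fix f g h c assume fgh: "f \<in> \<Lambda>" "g \<in> \<Lambda>" "h \<in> \<Lambda>"
  then show r: "interface_form T n \<Omega>s \<sigma>s h (\<lambda>x. c *\<^sub>R f x + g x)
    = c * interface_form T n \<Omega>s \<sigma>s h f + interface_form T n \<Omega>s \<sigma>s h g"
    by (rule interface_form_lincomb_right)
  show "interface_form T n \<Omega>s \<sigma>s (\<lambda>x. c *\<^sub>R f x + g x) h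
    = c * interface_form T n \<Omega>s \<sigma>s f h + interface_form T n \<Omega>s \<sigma>s g h"
    using r interface_form_symmetric[OF multiplier_lincomb[OF fgh(1,2)] fgh(3)]
      interface_form_symmetric[OF fgh(1,3)] interface_form_symmetric[OF fgh(2,3)] by simp
qed

text \<open>Uniform positivity of \<open>A\<close> bounds each local form below by a multiple of the
  squared stress norm, so a nonpositive total forces every summand to vanish. The stress is then
  zero almost everywhere, with no claim on individual points.\<close>

lemma stress_zero:
  assumes lam: "lam \<in> \<Lambda>" and "interface_form T n \<Omega>s \<sigma>s lam lam \<le> 0" and i: "i \<in> {1..n}"
  shows "AE x in lborel. x \<in> \<Omega>s i \<longrightarrow> \<sigma>s i lam x = 0"
proof -
  obtain a0 where a0: "a0 > 0" "\<And>x M. x \<in> \<Omega> \<Longrightarrow> a0 * (norm M)\<^sup>2 \<le> A x M \<bullet> M"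
    using tensor unfolding compliance_tensor_def by blast
  have \<sigma>L: "\<sigma>s i lam \<in> L2 (\<Omega>s i)" if "i \<in> {1..n}" for i
    using solution[OF that lam] local_L2(1)[OF that] by (simp add: local_solution_def)
  have coercive: "a0 * ip (\<Omega>s i) (\<sigma>s i lam) (\<sigma>s i lam) \<le> subdomain_form T n \<Omega>s \<sigma>s i lam lam"
    if i: "i \<in> {1..n}" for i
  proof -
    have AL: "(\<lambda>x. A x (\<sigma>s i lam x)) \<in> L2 (\<Omega>s i)"
      using tensor subdomain_props(7,3)[OF i] \<sigma>L[OF i] by (rule compliance_tensor_L2)
    have "a0 * ip (\<Omega>s i) (\<sigma>s i lam) (\<sigma>s i lam) = (LINT x:\<Omega>s i|lborel. a0 * (\<sigma>s i lam x \<bullet> \<sigma>s i lam x))"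
      unfolding ip_def by simp
    also have "\<dots> \<le> ip (\<Omega>s i) (\<lambda>x. A x (\<sigma>s i lam x)) (\<sigma>s i lam)"
      unfolding ip_def
    proof (rule set_integral_mono)
      show "set_integrable lborel (\<Omega>s i) (\<lambda>x. a0 * (\<sigma>s i lam x \<bullet> \<sigma>s i lam x))"
        using L2_inner_integrable[OF \<sigma>L[OF i] \<sigma>L[OF i]] by (rule set_integrable_mult_right)
      show "set_integrable lborel (\<Omega>s i) (\<lambda>x. A x (\<sigma>s i lam x) \<bullet> \<sigma>s i lam x)"
        using AL \<sigma>L[OF i] by (rule L2_inner_integrable)
      show "a0 * (\<sigma>s i lam x \<bullet> \<sigma>s i lam x) \<le> A x (\<sigma>s i lam x) \<bullet> \<sigma>s i lam x" if "x \<in> \<Omega>s i" for x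
        using a0(2)[of x "\<sigma>s i lam x"] that subdomain_props(7)[OF i] by (auto simp: power2_norm_eq_inner)
    qed
    finally show ?thesis unfolding subdomain_form_eq[OF i lam lam] .
  qed
  then have "(\<Sum>i\<in>{1..n}. a0 * ip (\<Omega>s i) (\<sigma>s i lam) (\<sigma>s i lam)) \<le> interface_form T n \<Omega>s \<sigma>s lam lam"
    unfolding interface_form_def by (rule sum_mono)
  then have le: "(\<Sum>i\<in>{1..n}. a0 * ip (\<Omega>s i) (\<sigma>s i lam) (\<sigma>s i lam)) \<le> 0" using assms(2) by simp
  have nn: "0 \<le> a0 * ip (\<Omega>s i) (\<sigma>s i lam) (\<sigma>s i lam)" for i
    using a0(1) ip_nonneg[of "\<Omega>s i" "\<sigma>s i lam"] by simp
  have "a0 * ip (\<Omega>s i) (\<sigma>s i lam) (\<sigma>s i lam) \<le> 0"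
    using member_le_sum[of i "{1..n}" "\<lambda>i. a0 * ip (\<Omega>s i) (\<sigma>s i lam) (\<sigma>s i lam)"] i nn le by auto
  then have "ip (\<Omega>s i) (\<sigma>s i lam) (\<sigma>s i lam) \<le> 0" using a0(1) by (simp add: mult_le_0_iff)
  then show ?thesis by (rule ip_self_zero_imp_AE_zero[OF \<sigma>L[OF i]])
qed

lemma interface_form_positive:
  assumes lam: "lam \<in> \<Lambda>" and nz: "\<not> (\<forall>i\<in>{1..n}. surf_eq (Gam1 T n \<Omega>s i) lam (\<lambda>x. 0))"
  shows "0 < interface_form T n \<Omega>s \<sigma>s lam lam"
proof (rule ccontr)
  assume "\<not> 0 < interface_form T n \<Omega>s \<sigma>s lam lam"
  then have le: "interface_form T n \<Omega>s \<sigma>s lam lam \<le> 0" by simp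
  have mem: "us i lam \<in> restr (\<Omega>s i) V" "\<gamma>s i lam \<in> restr (\<Omega>s i) W" if "i \<in> {1..n}" for i
    using solution[OF that lam] by (simp_all add: local_solution_def)
  \<comment> \<open>With the stress gone almost everywhere, the first local equation loses its
    \<open>A\<close> term.\<close>
  have eqn: "ip (\<Omega>s i) (us i lam) (wdiv (\<Omega>s i) \<tau>) + ip (\<Omega>s i) (\<gamma>s i lam) \<tau>
      = surf_ip (Gam1 T n \<Omega>s i) lam (ntrace T (\<Omega>s i) \<tau>)"
    if i: "i \<in> {1..n}" and \<tau>: "\<tau> \<in> restr (\<Omega>s i) X" for i \<tau>
  proof -
    have \<sigma>L: "\<sigma>s i lam \<in> L2 (\<Omega>s i)"
      using solution[OF i lam] local_L2(1)[OF i] by (simp add: local_solution_def)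
    have "AE x in lborel. x \<in> \<Omega>s i \<longrightarrow> A x (\<sigma>s i lam x) = 0"
      using stress_zero[OF lam le i]
    proof eventually_elim
      case (elim x)
      show ?case
      proof
        assume x: "x \<in> \<Omega>s i"
        then have "linear (A x)"
          using tensor subdomain_props(7)[OF i] unfolding compliance_tensor_def by blast
        then show "A x (\<sigma>s i lam x) = 0" using elim x by (simp add: linear_0)
      qed
    qed
    then have "ip (\<Omega>s i) (\<lambda>x. A x (\<sigma>s i lam x)) \<tau> = ip (\<Omega>s i) (\<lambda>x. 0) \<tau>"
      by (intro ip_cong_AE compliance_tensor_L2[OF tensor] subdomain_props i \<sigma>L L2_zero local_L2(1)[OF i] \<tau>)
    also have "\<dots> = 0" by (simp add: ip_def set_lebesgue_integral_def)
    finally have "ip (\<Omega>s i) (\<lambda>x. A x (\<sigma>s i lam x)) \<tau> = 0" .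
    moreover have "ip (\<Omega>s i) (\<lambda>x. A x (\<sigma>s i lam x)) \<tau> + ip (\<Omega>s i) (us i lam) (wdiv (\<Omega>s i) \<tau>)
        + ip (\<Omega>s i) (\<gamma>s i lam) \<tau> = surf_ip (Gam1 T n \<Omega>s i) lam (ntrace T (\<Omega>s i) \<tau>)"
      using solution[OF i lam] \<tau> unfolding local_solution_def by blast
    ultimately show ?thesis by simp
  qed
  \<comment> \<open>For a global field the local divergences may be replaced by the global one, and
    the right-hand sides add up to zero.\<close>
  have orth: "(\<Sum>i\<in>{1..n}. ip (\<Omega>s i) (us i lam) (wdiv \<Omega> \<tau>) + ip (\<Omega>s i) (\<gamma>s i lam) \<tau>) = 0"
    if \<tau>: "\<tau> \<in> X" for \<tau>
  proof -
    have "ip (\<Omega>s i) (us i lam) (wdiv \<Omega> \<tau>) + ip (\<Omega>s i) (\<gamma>s i lam) \<tau>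
        = surf_ip (Gam1 T n \<Omega>s i) lam (ntrace T (\<Omega>s i) (restriction i \<tau>))" if i: "i \<in> {1..n}" for i
    proof -
      have "ip (\<Omega>s i) (\<gamma>s i lam) \<tau> = ip (\<Omega>s i) (\<gamma>s i lam) (restriction i \<tau>)"
        by (rule ip_cong) (simp add: restriction_def)
      then show ?thesis
        using eqn[OF i restriction_mem[OF \<tau>]]
          ip_wdiv_restriction[OF \<tau> i local_L2(2)[OF i mem(1)[OF i]]] by simp
    qed
    then show ?thesis using sum_surf_ip_restriction_zero[OF \<tau> lam] by simp
  qed
  have "surf_eq (Gam1 T n \<Omega>s i) lam (\<lambda>x. 0)" if i: "i \<in> {1..n}" for i
  proof (rule multiplier_zero_if_orthogonal[OF lam i])
    fix \<tau> assume \<tau>: "\<tau> \<in> restr (\<Omega>s i) X"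
    have z: "ip (\<Omega>s i) (us i lam) (us i lam) = 0" "ip (\<Omega>s i) (\<gamma>s i lam) (\<gamma>s i lam) = 0"
      using broken_fields_zero[of "\<lambda>i. us i lam" "\<lambda>i. \<gamma>s i lam"] mem orth i by blast+
    \<comment> \<open>Vanishing squares give fields that are zero almost everywhere, which suffices
      to kill any pairing with a square integrable field.\<close>
    have zero: "ip (\<Omega>s i) v w = 0" if "v \<in> L2 (\<Omega>s i)" "ip (\<Omega>s i) v v = 0" "w \<in> L2 (\<Omega>s i)"
      for v w :: "real^'a \<Rightarrow> 'b::euclidean_space"
    proof -
      have "AE x in lborel. x \<in> \<Omega>s i \<longrightarrow> v x = 0"
        using that by (intro ip_self_zero_imp_AE_zero) auto
      then have "ip (\<Omega>s i) v w = ip (\<Omega>s i) (\<lambda>x. 0) w"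
        using that by (intro ip_cong_AE L2_zero)
      then show ?thesis by (simp add: ip_def set_lebesgue_integral_def)
    qed
    have "ip (\<Omega>s i) (us i lam) (wdiv (\<Omega>s i) \<tau>) = 0"
      by (rule zero[OF local_L2(2)[OF i mem(1)[OF i]] z(1) wdiv_L2[OF local_space(1)[OF i \<tau>]]])
    moreover have "ip (\<Omega>s i) (\<gamma>s i lam) \<tau> = 0"
      by (rule zero[OF local_L2(3)[OF i mem(2)[OF i]] z(2) local_L2(1)[OF i \<tau>]])
    ultimately show "surf_ip (Gam1 T n \<Omega>s i) lam (ntrace T (\<Omega>s i) \<tau>) = 0"
      using eqn[OF i \<tau>] by simp
  qed
  with nz show False by blast
qed

end


theorem lemma3p1:
  fixes \<Omega> \<Gamma>D \<Gamma>N :: "(real^'d) set"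
    and A :: "real^'d \<Rightarrow> real^'d^'d \<Rightarrow> real^'d^'d"
    and T :: "(real^'d) set set"
    and X :: "'d mfield set" and V :: "'d vfield set" and W :: "'d mfield set"
    and n :: nat and \<Omega>s :: "nat \<Rightarrow> (real^'d) set"
    and \<sigma>s :: "nat \<Rightarrow> 'd vfield \<Rightarrow> 'd mfield"
    and us :: "nat \<Rightarrow> 'd vfield \<Rightarrow> 'd vfield"
    and \<gamma>s :: "nat \<Rightarrow> 'd vfield \<Rightarrow> 'd mfield"
    and \<kappa> \<beta> :: real
  defines "\<Lambda> \<equiv> multiplier_space T n \<Omega>s X"
    and "a \<equiv> interface_form T n \<Omega>s \<sigma>s"
  assumes "CARD('d) \<in> {2, 3}"
    and "polygonal_domain \<Omega>" and "simply_connected \<Omega>"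
    and "is_mesh \<kappa> \<Omega> T"
    and "boundary_partition T \<Omega> \<Gamma>D \<Gamma>N"
    and "compliance_tensor \<Omega> A"
    and "decomposition \<kappa> T \<Omega> n \<Omega>s"
    and "0 < \<beta>"
    and "stable_triple \<beta> T \<Omega> \<Gamma>N X V W"
    and "\<forall>i\<in>{1..n}. stable_triple \<beta> T (\<Omega>s i) \<Gamma>N
           (restr (\<Omega>s i) X) (restr (\<Omega>s i) V) (restr (\<Omega>s i) W)"
    and "inf_sup \<beta> \<Omega> X (broken n \<Omega>s V) (broken n \<Omega>s W)"
    and "independent_traces T n \<Omega>s X"
    and "\<forall>i\<in>{1..n}. \<forall>lam\<in>\<Lambda>.
           local_solution T n \<Omega>s A X V W i lam (\<sigma>s i lam) (us i lam) (\<gamma>s i lam)"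
  shows "bilinear_form_on \<Lambda> a
    \<and> (\<forall>lam\<in>\<Lambda>. \<forall>\<eta>\<in>\<Lambda>. a lam \<eta> = a \<eta> lam)
    \<and> (\<forall>lam\<in>\<Lambda>. \<not> (\<forall>i\<in>{1..n}. surf_eq (Gam1 T n \<Omega>s i) lam (\<lambda>x. 0)) \<longrightarrow> 0 < a lam lam)"
proof -
  interpret elasticity_decomposition \<kappa> \<beta> \<Omega> \<Gamma>N A T X V W n \<Omega>s
    by standard (fact assms(4,6,8-11,13,14) bspec[OF assms(12)])+
  interpret interface_problem \<kappa> \<beta> \<Omega> \<Gamma>N A T X V W n \<Omega>s \<sigma>s us \<gamma>s
    by standard (rule bspec[OF bspec[OF assms(15)], unfolded assms(1)])
  show ?thesis
    unfolding assms(1,2)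
    by (intro conjI ballI impI interface_form_bilinear interface_form_symmetric interface_form_positive)
qed

end
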